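(* Let $\mathcal{F}$ be a germ of singular holomorphic foliation at $(\mathbb{C}^2,0)$ defined by $\omega=P\,dx+Q\,dy$ with an isolated singularity at $0$, and assume that $\nu(\mathcal{F})=\nu(P)\le \nu(Q)$. Then for every integer $k\ge 0$, $$\mu^{k}(\mathcal{F})=\mu(\mathcal{F})+\dim_{\mathbb{C}}\frac{\mathcal{O}_2}{\mathfrak{m}^{k}}+\dim_{\mathbb{C}}\frac{\mathcal{O}_2}{\langle P\rangle+\mathfrak{m}^{k}}.$$
   Context: $\mathcal{O}_2=\mathbb{C}\{x,y\}$ is the ring of germs of holomorphic functions at $0\in\mathbb{C}^2$, $\mathfrak{m}$ is its maximal ideal, and $\mathfrak{m}^0=\mathcal{O}_2$. For $g\in\mathcal{O}_2$, $\nu(g)$ is the algebraic multiplicity (order of vanishing) of $g$ at $0$. A germ of singular foliation $\mathcal{F}$ at $(\mathbb{C}^2,0)$ with isolated singularity at $0$ is given by $\omega=P\,dx+Q\,dy$ with $P,Q\in\mathfrak{m}$ relatively prime; its algebraic multiplicity is $\nu(\mathcal{F})=\min\{\nu(P),\nu(Q)\}$. For an integer $k\ge0$ the $k$-th Milnor number of $\mathcal{F}$ is $\mu^k(\mathcal{F})=\dim_{\mathbb{C}}\mathcal{O}_2/(\langle P,Q\rangle\mathfrak{m}^k)$, and $\mu(\mathcal{F})=\mu^0(\mathcal{F})=\dim_{\mathbb{C}}\mathcal{O}_2/\langle P,Q\rangle$. *)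

theory Defs
  imports
    "HOL-Complex_Analysis.Complex_Analysis"
    "HOL-Library.Extended_Nat"
    "HOL-Library.Set_Algebras"
begin

text \<open>
  Holomorphic near 0 means complex (Frechet) differentiable at every point of some
  neighbourhood of 0; the derivative \<open>(u, v) \<mapsto> a * u + b * v\<close> is complex linear.
\<close>

definition holo_near_0 :: "(complex \<times> complex \<Rightarrow> complex) \<Rightarrow> bool" where
  "holo_near_0 f \<longleftrightarrow>
     (\<forall>\<^sub>F p in nhds 0. \<exists>a b. (f has_derivative (\<lambda>(u, v). a * u + b * v)) (at p))"

definition germ_eq ::
  "(complex \<times> complex \<Rightarrow> complex) \<Rightarrow> (complex \<times> complex \<Rightarrow> complex) \<Rightarrow> bool" where
  "germ_eq f g \<longleftrightarrow> holo_near_0 f \<and> holo_near_0 g \<and> (\<forall>\<^sub>F p in nhds 0. f p = g p)"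

lemma holo_near_0_const: "holo_near_0 (\<lambda>_. c)"
  unfolding holo_near_0_def
proof (intro always_eventually allI exI)
  fix p :: "complex \<times> complex"
  show "((\<lambda>_. c) has_derivative (\<lambda>(u, v). 0 * u + 0 * v)) (at p)"
    by (simp add: case_prod_unfold)
qed

lemma holo_near_0_add:
  assumes "holo_near_0 f" "holo_near_0 g"
  shows "holo_near_0 (\<lambda>p. f p + g p)"
  using assms unfolding holo_near_0_def
proof eventually_elim
  case (elim p)
  then obtain a b c d where
    "(f has_derivative (\<lambda>(u, v). a * u + b * v)) (at p)"
    "(g has_derivative (\<lambda>(u, v). c * u + d * v)) (at p)" by blast
  then have "((\<lambda>p. f p + g p) has_derivative
      (\<lambda>x. (case x of (u, v) \<Rightarrow> a * u + b * v) + (case x of (u, v) \<Rightarrow> c * u + d * v))) (at p)"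
    by (rule has_derivative_add)
  then have "((\<lambda>p. f p + g p) has_derivative (\<lambda>(u, v). (a + c) * u + (b + d) * v)) (at p)"
    by (simp add: case_prod_unfold algebra_simps)
  then show ?case by blast
qed

lemma holo_near_0_mult:
  assumes "holo_near_0 f" "holo_near_0 g"
  shows "holo_near_0 (\<lambda>p. f p * g p)"
  using assms unfolding holo_near_0_def
proof eventually_elim
  case (elim p)
  then obtain a b c d where
    "(f has_derivative (\<lambda>(u, v). a * u + b * v)) (at p)"
    "(g has_derivative (\<lambda>(u, v). c * u + d * v)) (at p)" by blast
  then have "((\<lambda>p. f p * g p) has_derivative
      (\<lambda>x. f p * (case x of (u, v) \<Rightarrow> c * u + d * v) +
           (case x of (u, v) \<Rightarrow> a * u + b * v) * g p)) (at p)"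
    by (rule has_derivative_mult)
  then have "((\<lambda>p. f p * g p) has_derivative
      (\<lambda>(u, v). (f p * c + a * g p) * u + (f p * d + b * g p) * v)) (at p)"
    by (simp add: case_prod_unfold algebra_simps)
  then show ?case by blast
qed

lemma holo_near_0_uminus: "holo_near_0 f \<Longrightarrow> holo_near_0 (\<lambda>p. - f p)"
  using holo_near_0_mult[OF holo_near_0_const[of "-1"], of f] by simp

lemma holo_near_0_diff:
  "holo_near_0 f \<Longrightarrow> holo_near_0 g \<Longrightarrow> holo_near_0 (\<lambda>p. f p - g p)"
  using holo_near_0_add[OF _ holo_near_0_uminus, of f g] by simp

quotient_type germ2 = "complex \<times> complex \<Rightarrow> complex" / partial: germ_eq
proof (rule part_equivpI)
  show "\<exists>f. germ_eq f f"
    by (rule exI[of _ "\<lambda>_. 0"]) (simp add: germ_eq_def holo_near_0_const)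
  show "symp germ_eq"
    by (auto simp: symp_def germ_eq_def eq_commute)
  show "transp germ_eq"
    by (auto simp: transp_def germ_eq_def elim: eventually_elim2)
qed

instantiation germ2 :: comm_ring_1
begin

lift_definition zero_germ2 :: germ2 is "\<lambda>_. 0"
  by (simp add: germ_eq_def holo_near_0_const)

lift_definition one_germ2 :: germ2 is "\<lambda>_. 1"
  by (simp add: germ_eq_def holo_near_0_const)

lift_definition plus_germ2 :: "germ2 \<Rightarrow> germ2 \<Rightarrow> germ2" is "\<lambda>f g p. f p + g p"
  by (auto simp: germ_eq_def holo_near_0_add elim: eventually_elim2)

lift_definition minus_germ2 :: "germ2 \<Rightarrow> germ2 \<Rightarrow> germ2" is "\<lambda>f g p. f p - g p"
  by (auto simp: germ_eq_def holo_near_0_diff elim: eventually_elim2)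

lift_definition uminus_germ2 :: "germ2 \<Rightarrow> germ2" is "\<lambda>f p. - f p"
  by (auto simp: germ_eq_def holo_near_0_uminus elim: eventually_mono)

lift_definition times_germ2 :: "germ2 \<Rightarrow> germ2 \<Rightarrow> germ2" is "\<lambda>f g p. f p * g p"
  by (auto simp: germ_eq_def holo_near_0_mult elim: eventually_elim2)

instance
proof
  fix a b c :: germ2
  show "a * b * c = a * (b * c)"
    by transfer (simp add: germ_eq_def holo_near_0_mult mult.assoc)
  show "a * b = b * a"
    by transfer (simp add: germ_eq_def holo_near_0_mult mult.commute)
  show "1 * a = a"
    by transfer (simp add: germ_eq_def)
  show "a + b + c = a + (b + c)"
    by transfer (simp add: germ_eq_def holo_near_0_add add.assoc)
  show "a + b = b + a"
    by transfer (simp add: germ_eq_def holo_near_0_add add.commute)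
  show "0 + a = a"
    by transfer (simp add: germ_eq_def)
  show "- a + a = 0"
    by transfer (simp add: germ_eq_def holo_near_0_const)
  show "a - b = a + - b"
    by transfer (simp add: germ_eq_def holo_near_0_diff)
  show "(a + b) * c = a * c + b * c"
    by transfer (simp add: germ_eq_def holo_near_0_mult holo_near_0_add distrib_right)
  show "(0::germ2) \<noteq> 1"
    by transfer (auto simp: germ_eq_def dest: eventually_nhds_x_imp_x)
qed

end

lift_definition germ_const :: "complex \<Rightarrow> germ2" is "\<lambda>c _. c"
  by (simp add: germ_eq_def holo_near_0_const)

lift_definition germ_at_0 :: "germ2 \<Rightarrow> complex" is "\<lambda>f. f 0"
  by (auto simp: germ_eq_def dest: eventually_nhds_x_imp_x)

lift_definition germ_partial :: "nat \<Rightarrow> nat \<Rightarrow> germ2 \<Rightarrow> complex" is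
  "\<lambda>i j f. (deriv ^^ i) (\<lambda>x. (deriv ^^ j) (\<lambda>y. f (x, y)) 0) 0"
proof -
  fix i j f g
  assume "germ_eq f g"
  then have "\<forall>\<^sub>F p in nhds 0 \<times>\<^sub>F nhds 0. f p = g p"
    by (simp add: germ_eq_def nhds_prod[symmetric] zero_prod_def)
  then have "\<forall>\<^sub>F x in nhds 0. \<forall>\<^sub>F y in nhds 0. f (x, y) = g (x, y)"
    by (rule eventually_eventually_prod_filter1)
  then have "\<forall>\<^sub>F x in nhds 0.
      (deriv ^^ j) (\<lambda>y. f (x, y)) 0 = (deriv ^^ j) (\<lambda>y. g (x, y)) 0"
    by eventually_elim (rule higher_deriv_cong_ev[OF _ refl])
  then show "(deriv ^^ i) (\<lambda>x. (deriv ^^ j) (\<lambda>y. f (x, y)) 0) 0 =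
      (deriv ^^ i) (\<lambda>x. (deriv ^^ j) (\<lambda>y. g (x, y)) 0) 0"
    by (rule higher_deriv_cong_ev[OF _ refl])
qed

text \<open>
  Algebraic multiplicity: the least total order of a partial derivative that does not vanish
  at 0, i.e. the lowest degree occurring in the Taylor expansion. It is \<open>\<infinity>\<close> for the zero germ.
\<close>

definition germ_mult :: "germ2 \<Rightarrow> enat" where
  "germ_mult g = (INF (i, j) \<in> {(i, j). germ_partial i j g \<noteq> 0}. enat (i + j))"

definition ideal_gen :: "germ2 set \<Rightarrow> germ2 set" where
  "ideal_gen S = module.span (*) S"

definition ideal_prod :: "germ2 set \<Rightarrow> germ2 set \<Rightarrow> germ2 set" where
  "ideal_prod I J = ideal_gen {a * b | a b. a \<in> I \<and> b \<in> J}"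

primrec ideal_power :: "germ2 set \<Rightarrow> nat \<Rightarrow> germ2 set" where
  "ideal_power I 0 = UNIV"
| "ideal_power I (Suc k) = ideal_prod I (ideal_power I k)"

definition max_ideal :: "germ2 set" where
  "max_ideal = {g. germ_at_0 g = 0}"

text \<open>
  For a complex subspace \<open>W\<close> and finite \<open>B\<close>, \<open>quot_basis W B\<close> says that the classes
  modulo \<open>W\<close> of the elements of \<open>B\<close> (which are then pairwise distinct) form a basis of the
  quotient of the whole space by \<open>W\<close>.
\<close>

definition quot_basis :: "germ2 set \<Rightarrow> germ2 set \<Rightarrow> bool" where
  "quot_basis W B \<longleftrightarrow>
     (\<forall>u. (\<Sum>b\<in>B. germ_const (u b) * b) \<in> W \<longrightarrow> (\<forall>b\<in>B. u b = 0)) \<and>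
     (\<forall>f. \<exists>u. f - (\<Sum>b\<in>B. germ_const (u b) * b) \<in> W)"

definition quot_dim :: "germ2 set \<Rightarrow> enat" where
  "quot_dim W =
     (if \<exists>B. finite B \<and> quot_basis W B
      then enat (card (SOME B. finite B \<and> quot_basis W B)) else \<infinity>)"

text \<open>
  A foliation with isolated singularity is represented by the coefficients \<open>P\<close>, \<open>Q\<close> of a
  defining 1-form \<open>P dx + Q dy\<close>.
\<close>

definition relatively_prime :: "germ2 \<Rightarrow> germ2 \<Rightarrow> bool" where
  "relatively_prime P Q \<longleftrightarrow> (\<forall>d. d dvd P \<longrightarrow> d dvd Q \<longrightarrow> d dvd 1)"

definition singular_foliation :: "germ2 \<Rightarrow> germ2 \<Rightarrow> bool" where
  "singular_foliation P Q \<longleftrightarrow> P \<in> max_ideal \<and> Q \<in> max_ideal \<and> relatively_prime P Q"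

definition foliation_mult :: "germ2 \<Rightarrow> germ2 \<Rightarrow> enat" where
  "foliation_mult P Q = min (germ_mult P) (germ_mult Q)"

definition milnor_k :: "nat \<Rightarrow> germ2 \<Rightarrow> germ2 \<Rightarrow> enat" where
  "milnor_k k P Q = quot_dim (ideal_prod (ideal_gen {P, Q}) (ideal_power max_ideal k))"

definition milnor :: "germ2 \<Rightarrow> germ2 \<Rightarrow> enat" where
  "milnor P Q = quot_dim (ideal_gen {P, Q})"

end

theory Submission
  imports Defs
begin

text \<open>
  Put \<open>N = m\<^sup>k\<close>. In the chain \<open>P N + Q N \<subseteq> P O + Q N \<subseteq> P O + Q O \<subseteq> O\<close>, multiplication by \<open>P\<close> maps \<open>O\<close> onto
  the first quotient with kernel \<open>N\<close>, and multiplication by \<open>Q\<close> maps \<open>O\<close> onto the second one with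
  kernel \<open>P O + N\<close>, so the codimensions add up, finite or not. Both kernels rest on the fact that
  \<open>P\<close> divides \<open>b\<close> as soon as it divides \<open>b Q\<close>; the first one uses in addition that \<open>c P \<in> N\<close> implies
  \<open>c Q \<in> N\<close>, because the order of vanishing is additive and that of \<open>P\<close> is at most that of \<open>Q\<close>.
  Germs are handled through their Taylor series, an isomorphism onto the formal power series with
  geometrically bounded coefficients.
\<close>

text \<open>Coprimality is given by common divisors alone, so passing from
  \<open>P dvd b * Q\<close> to \<open>P dvd b\<close> is the algebraic obstacle. In place of unique
  factorization, the colon ideal (P : Q) is shown to be principal when P does not vanish identically
  on y = 0, and powers of y are split off from a general P. The analytic obstacle is that the
  division is first carried out formally, one power of y at a time;
  \<open>convergent_fps2_quotient\<close> shows that a formal quotient of convergent series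
  converges if the divisor does not vanish identically on y = 0. The passage between series and
  functions also turns m^k into the condition that all coefficients of total degree below k
  vanish.\<close>

unbundle no vec_syntax

section \<open>Codimension of subspaces\<close>

text \<open>All infinite sizes are identified, as in \<open>quot_dim\<close>, so that cardinalities
  add without finiteness assumptions.\<close>

definition ecard :: "'a set \<Rightarrow> enat" where
  "ecard A = (if finite A then enat (card A) else \<infinity>)"

lemma ecard_bij_betw: "bij_betw f A B \<Longrightarrow> ecard A = ecard B"
  by (auto simp: ecard_def bij_betw_finite bij_betw_same_card)

lemma ecard_Un_disjoint: "A \<inter> B = {} \<Longrightarrow> ecard (A \<union> B) = ecard A + ecard B"
  by (auto simp: ecard_def card_Un_disjoint)

section \<open>Bases sharing a common subset\<close>

context vector_space
begin

text \<open>The representation of v in E is supported both in A and in B, hence is zero.\<close>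

lemma span_Int_span_disjoint:
  assumes "independent E" "A \<subseteq> E" "B \<subseteq> E" "A \<inter> B = {}" "v \<in> span A" "v \<in> span B"
  shows "v = 0"
proof -
  have A: "representation E v = representation A v"
    using representation_extend[OF assms(1,5,2)] .
  have B: "representation E v = representation B v"
    using representation_extend[OF assms(1,6,3)] .
  have "representation E v b = 0" for b
    using representation_ne_zero[of A v b] representation_ne_zero[of B v b] A B assms(4) by auto
  moreover have "v \<in> span E"
    using assms(2,5) span_mono by blast
  ultimately show ?thesis
    using sum_nonzero_representation_eq[OF assms(1), of v] by simp
qed

text \<open>If a in A is a combination x + y of the other vectors, with y in the span of B, then y =
  a - x lies in both spans and is 0.\<close>

lemma independent_Un:
  assumes A: "independent A" and B: "independent B"
    and AB: "\<And>v. v \<in> span A \<Longrightarrow> v \<in> span B \<Longrightarrow> v = 0"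
  shows "independent (A \<union> B)"
proof -
  have aux: "a \<notin> span (X \<union> Y - {a})"
    if "a \<in> X" "independent X" and XY: "\<And>v. v \<in> span X \<Longrightarrow> v \<in> span Y \<Longrightarrow> v = 0" for a X Y
  proof
    assume "a \<in> span (X \<union> Y - {a})"
    then have "a \<in> span ((X - {a}) \<union> Y)"
      using span_mono[of "X \<union> Y - {a}" "(X - {a}) \<union> Y"] by blast
    then obtain x y where xy: "a = x + y" "x \<in> span (X - {a})" "y \<in> span Y"
      unfolding span_Un by blast
    have "a - x \<in> span X"
      using that(1) xy(2) span_mono[of "X - {a}" X] by (auto intro: span_diff span_base)
    then have "y = 0" using XY xy by simp
    then show False using xy that(1,2) by (auto simp: dependent_def)
  qed
  show ?thesis
    unfolding dependent_def
    using aux[of _ A B] aux[of _ B A] A B AB by (auto simp: Un_commute)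
qed

text \<open>In place of a quotient map, the projection q kills C and fixes D - C. Its kernel on the
  common span is \<open>span C\<close>, which meets \<open>span (E - C)\<close> only in 0. So q maps
  E - C to a second basis of \<open>span (D - C)\<close>, and two bases of one space are in
  bijection.\<close>

lemma bij_betw_basis_Diff:
  assumes D: "independent D" "C \<subseteq> D" and E: "independent E" "C \<subseteq> E" and DE: "span D = span E"
  shows "\<exists>f. bij_betw f (E - C) (D - C)"
proof -
  interpret VP: vector_space_pair scale scale ..
  define q where "q = VP.construct D (\<lambda>b. if b \<in> C then 0 else b)"
  have lin: "Vector_Spaces.linear scale scale q"
    unfolding q_def by (rule VP.linear_construct[OF D(1)])
  have qC: "q b = 0" if "b \<in> C" for b
    using VP.construct_basis[OF D(1), of b "\<lambda>b. if b \<in> C then 0 else b"] that D(2)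
    by (auto simp: q_def)
  have qD: "q b = b" if "b \<in> D - C" for b
    using VP.construct_basis[OF D(1), of b "\<lambda>b. if b \<in> C then 0 else b"] that
    by (auto simp: q_def)
  have qC': "q v = 0" if "v \<in> span C" for v
    using VP.linear_eq_0_on_span[OF lin qC that] by simp
  have qD': "q v = v" if "v \<in> span (D - C)" for v
    using VP.linear_eq_on[OF lin linear_ident that] qD by simp
  have inj: "inj_on q (span (E - C))"
  proof (subst VP.linear_inj_on_iff_eq_0[OF lin subspace_span], intro ballI impI)
    fix v assume v: "v \<in> span (E - C)" "q v = 0"
    have "v \<in> span (C \<union> (D - C))"
      using v(1) span_mono[of "E - C" E] DE D(2) by (auto simp: Un_absorb1)
    then obtain c d where cd: "v = c + d" "c \<in> span C" "d \<in> span (D - C)"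
      unfolding span_Un by blast
    have "q v = d"
      using cd qC' qD' by (simp add: VP.linear_add[OF lin])
    then have "v \<in> span C"
      using cd v by simp
    then show "v = 0"
      using span_Int_span_disjoint[OF E(1), of C "E - C"] E(2) v(1) by auto
  qed
  have ind: "independent (q ` (E - C))"
    using VP.linear_independent_injective_image[OF lin _ inj] independent_mono[OF E(1)] by blast
  have img: "span (q ` (X - C)) = q ` span X" if "C \<subseteq> X" for X
  proof -
    have "span (q ` X) = span (q ` (X - C))"
    proof (rule span_eq[THEN iffD2], intro conjI subsetI)
      fix x assume "x \<in> q ` X"
      then obtain b where "b \<in> X" "x = q b" by blast
      then show "x \<in> span (q ` (X - C))"
        by (cases "b \<in> C") (auto simp: qC intro: span_base span_zero)
    qed (auto intro: span_base)
    then show ?thesis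
      using VP.linear_span_image[OF lin] by simp
  qed
  have "q ` (D - C) = D - C"
    using qD by auto
  then have "span (q ` (E - C)) = span (D - C)"
    using img[OF E(2)] img[OF D(2)] DE by simp
  then obtain g where "bij_betw g (q ` (E - C)) (D - C)"
    using bij_if_span_eq_span_bases[OF ind independent_mono[OF D(1)]] by blast
  moreover have "bij_betw q (E - C) (q ` (E - C))"
    using inj_on_subset[OF inj span_superset] by (simp add: bij_betw_def)
  ultimately show ?thesis
    using bij_betw_trans by blast
qed

lemma basis_extension:
  assumes "independent C" "span C \<subseteq> W" "subspace W"
  obtains D where "C \<subseteq> D" "independent D" "span D = W"
proof -
  obtain D where D: "C \<subseteq> D" "D \<subseteq> W" "independent D" "W \<subseteq> span D"
    using maximal_independent_subset_extend[of C W] assms span_superset[of C] by blast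
  with assms(3) show ?thesis
    by (intro that[of D]) (auto dest: span_minimal)
qed

end

section \<open>Germs as a complex vector space\<close>

lemma germ_const_add: "germ_const (a + b) = germ_const a + germ_const b"
  by transfer (simp add: germ_eq_def holo_near_0_const)

lemma germ_const_mult: "germ_const (a * b) = germ_const a * germ_const b"
  by transfer (simp add: germ_eq_def holo_near_0_const)

lemma germ_const_1: "germ_const 1 = 1"
  by transfer (simp add: germ_eq_def holo_near_0_const)

text \<open>\<open>GV\<close> carries the complex dimension, while the subspaces of
  \<open>GI\<close> below are the ideals.\<close>

interpretation GV: vector_space "\<lambda>c (g::germ2). germ_const c * g"
  by unfold_locales (simp_all add: germ_const_add germ_const_mult germ_const_1 algebra_simps)

interpretation GVP: vector_space_pair
  "\<lambda>c (g::germ2). germ_const c * g" "\<lambda>c (g::germ2). germ_const c * g" ..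

interpretation GI: module "(*) :: germ2 \<Rightarrow> germ2 \<Rightarrow> germ2"
  by unfold_locales (simp_all add: algebra_simps)

text \<open>As a simp rule, \<open>scale_scale\<close> of the regular module loops with \<open>mult.assoc\<close>.\<close>

declare GI.scale_scale [simp del]

lemma ideal_imp_GV_subspace: "GI.subspace I \<Longrightarrow> GV.subspace I"
  unfolding GV.subspace_def GI.subspace_def by blast

text \<open>With a basis C of W fixed, independence and spanning modulo W become independence and
  spanning of B together with C, and no quotient space has to be formed.\<close>

lemma quot_basis_iff_independent:
  assumes C: "GV.independent C" "GV.span C = W" and B: "finite B"
  shows "quot_basis W B \<longleftrightarrow> B \<inter> C = {} \<and> GV.independent (B \<union> C) \<and> GV.span (B \<union> C) = UNIV"
proof -
  have W: "GV.subspace W" using C by auto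
  have fin: "GV.span B = range (\<lambda>u. \<Sum>b\<in>B. germ_const (u b) * b)"
    using GV.span_finite[OF B] .
  have spans: "(\<forall>f. \<exists>u. f - (\<Sum>b\<in>B. germ_const (u b) * b) \<in> W) \<longleftrightarrow> GV.span (B \<union> C) = UNIV"
  proof -
    have "GV.span (B \<union> C) = {x + y |x y. x \<in> GV.span B \<and> y \<in> W}"
      using GV.span_Un[of B C] C by simp
    also have "\<dots> = {f. \<exists>u. f - (\<Sum>b\<in>B. germ_const (u b) * b) \<in> W}"
    proof (intro equalityI subsetI)
      fix f assume "f \<in> {x + y |x y. x \<in> GV.span B \<and> y \<in> W}"
      then obtain u y where "f = (\<Sum>b\<in>B. germ_const (u b) * b) + y" "y \<in> W"
        unfolding fin by blast
      then show "f \<in> {f. \<exists>u. f - (\<Sum>b\<in>B. germ_const (u b) * b) \<in> W}"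
        by (auto intro!: exI[of _ u])
    next
      fix f assume "f \<in> {f. \<exists>u. f - (\<Sum>b\<in>B. germ_const (u b) * b) \<in> W}"
      then obtain u where u: "f - (\<Sum>b\<in>B. germ_const (u b) * b) \<in> W" by blast
      have "f = (\<Sum>b\<in>B. germ_const (u b) * b) + (f - (\<Sum>b\<in>B. germ_const (u b) * b))"
        by simp
      then show "f \<in> {x + y |x y. x \<in> GV.span B \<and> y \<in> W}"
        using u unfolding fin by blast
    qed
    finally show ?thesis by auto
  qed
  have indep: "(\<forall>u. (\<Sum>b\<in>B. germ_const (u b) * b) \<in> W \<longrightarrow> (\<forall>b\<in>B. u b = 0)) \<longleftrightarrow>
      B \<inter> C = {} \<and> GV.independent (B \<union> C)"
  proof (intro iffI conjI allI impI ballI)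
    assume *: "\<forall>u. (\<Sum>b\<in>B. germ_const (u b) * b) \<in> W \<longrightarrow> (\<forall>b\<in>B. u b = 0)"
    have single: "b \<notin> GV.span (B - {b} \<union> C)" if b: "b \<in> B" for b
    proof
      assume "b \<in> GV.span (B - {b} \<union> C)"
      then obtain x y where xy: "b = x + y" "x \<in> GV.span (B - {b})" "y \<in> W"
        unfolding GV.span_Un C by blast
      then obtain v where v: "x = (\<Sum>c\<in>B - {b}. germ_const (v c) * c)"
        using GV.span_finite[of "B - {b}"] B by auto
      \<comment> \<open>Brings the relation b = x + y into the form used by
        \<open>quot_basis\<close>, with coefficient 1 at b.\<close>
      define u where "u c = (if c = b then 1 else - v c)" for c
      have "(\<Sum>c\<in>B. germ_const (u c) * c) = b + (\<Sum>c\<in>B - {b}. germ_const (u c) * c)"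
        using b B by (subst sum.remove[of _ b]) (auto simp: germ_const_1 u_def)
      also have "(\<Sum>c\<in>B - {b}. germ_const (u c) * c) = (\<Sum>c\<in>B - {b}. - (germ_const (v c) * c))"
        by (intro sum.cong) (auto simp: u_def GV.scale_minus_left)
      also have "b + \<dots> = b - x" by (simp add: sum_negf v)
      also have "\<dots> = y" using xy(1) by simp
      finally have "u b = 0"
        using * xy(3) b by metis
      then show False by (simp add: u_def)
    qed
    show disj: "B \<inter> C = {}"
      using single GV.span_base by blast
    show "GV.independent (B \<union> C)"
    proof -
      \<comment> \<open>C may be infinite, so the elements of the finite B are adjoined to it one at
        a time.\<close>
      have "GV.independent (A \<union> C)" if "A \<subseteq> B" "finite A" for A
        using that(2,1)
      proof induction
        case (insert b A)
        have "b \<notin> GV.span (A \<union> C)"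
          using single[of b] insert GV.span_mono[of "A \<union> C" "B - {b} \<union> C"] by blast
        then show ?case using insert GV.independent_insertI[of b "A \<union> C"] by auto
      qed (use C in auto)
      then show ?thesis using B by blast
    qed
  next
    fix u b assume a: "B \<inter> C = {} \<and> GV.independent (B \<union> C)"
      and u: "(\<Sum>b\<in>B. germ_const (u b) * b) \<in> W" and b: "b \<in> B"
    have "(\<Sum>b\<in>B. germ_const (u b) * b) = 0"
      using GV.span_Int_span_disjoint[of "B \<union> C" B C] a u C fin by blast
    moreover have "GV.independent B"
      using a GV.independent_mono by blast
    ultimately show "u b = 0"
      using GV.independentD[OF _ B] b by blast
  qed
  show ?thesis
    unfolding quot_basis_def spans indep by auto
qed

lemma quot_dim_eq_ecard:
  assumes C: "GV.span C = W" "C \<subseteq> D" and D: "GV.independent D" "GV.span D = UNIV"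
  shows "quot_dim W = ecard (D - C)"
proof -
  have iC: "GV.independent C" using D C GV.independent_mono by blast
  have bas: "finite B \<and> ecard B = ecard (D - C)" if B: "finite B" "quot_basis W B" for B
  proof -
    have *: "B \<inter> C = {}" "GV.independent (B \<union> C)" "GV.span (B \<union> C) = UNIV"
      using quot_basis_iff_independent[OF iC C(1) B(1)] B(2) by auto
    obtain f where "bij_betw f ((B \<union> C) - C) (D - C)"
      using GV.bij_betw_basis_Diff[OF D(1) C(2) *(2)] * D by auto
    moreover have "(B \<union> C) - C = B" using * by auto
    ultimately show ?thesis using B ecard_bij_betw by metis
  qed
  show ?thesis
  proof (cases "finite (D - C)")
    case True
    have "quot_basis W (D - C)"
      using quot_basis_iff_independent[OF iC C(1) True] C D by (auto simp: Un_absorb2)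
    with True have ex: "\<exists>B. finite B \<and> quot_basis W B" by blast
    from someI_ex[OF this] bas[of "SOME B. finite B \<and> quot_basis W B"]
    show ?thesis using ex by (auto simp: quot_dim_def ecard_def)
  next
    case False
    then have "\<not> (\<exists>B. finite B \<and> quot_basis W B)"
      using bas by (metis ecard_def enat.distinct(2))
    then show ?thesis using False by (simp add: quot_dim_def ecard_def)
  qed
qed

text \<open>\<phi> induces an isomorphism from the whole space modulo the preimage of W onto U / W,
  and codimensions add along W, U and the whole space. It is meant for multiplication by P and by
  Q.\<close>

lemma quot_dim_subspace_eq:
  assumes W: "GV.subspace W" and lin: "Vector_Spaces.linear (\<lambda>c g. germ_const c * g) (\<lambda>c g. germ_const c * g) \<phi>"
    and U: "U = range \<phi> + W"
  shows "quot_dim W = quot_dim U + quot_dim (\<phi> -` W)"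
proof -
  have K: "GV.subspace (\<phi> -` W)"
    using GVP.linear_subspace_vimage[OF lin W] .
  obtain A where A: "GV.independent A" "GV.span A = \<phi> -` W"
    using GV.basis_extension[of "{}"] K GV.subspace_0 by (metis GV.independent_empty GV.span_empty empty_subsetI insert_subset)
  obtain B where B: "A \<subseteq> B" "GV.independent B" "GV.span B = UNIV"
    using GV.basis_extension[of A UNIV] A GV.subspace_UNIV by blast
  obtain C where C: "GV.independent C" "GV.span C = W"
    using GV.basis_extension[of "{}"] W GV.subspace_0 by (metis GV.independent_empty GV.span_empty empty_subsetI insert_subset)
  \<comment> \<open>S lifts a basis of the space modulo the preimage of W, so \<phi> is injective on
    its span and the image of that span meets W only in 0.\<close>
  define S where "S = B - A"
  have SA: "v = 0" if "v \<in> GV.span S" "\<phi> v \<in> W" for v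
    using GV.span_Int_span_disjoint[OF B(2), of A S v] that A B by (auto simp: S_def)
  have inj: "inj_on \<phi> (GV.span S)"
    using GVP.linear_inj_on_iff_eq_0[OF lin GV.subspace_span] SA GV.subspace_0[OF W] by auto
  have spanS: "GV.span (\<phi> ` S) = \<phi> ` GV.span S"
    using GVP.linear_span_image[OF lin] .
  have ind: "GV.independent (\<phi> ` S)"
    using GVP.linear_independent_injective_image[OF lin _ inj] B GV.independent_mono[of B S] by (auto simp: S_def)
  have int0: "v = 0" if "v \<in> GV.span (\<phi> ` S)" "v \<in> GV.span C" for v
    using that SA C GVP.linear_0[OF lin] unfolding spanS by auto
  have disj: "\<phi> ` S \<inter> C = {}"
    using int0 GV.span_base ind GV.dependent_zero by (metis disjoint_iff)
  have ind2: "GV.independent (\<phi> ` S \<union> C)"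
    using GV.independent_Un[OF ind C(1)] int0 by blast
  have spanU: "GV.span (\<phi> ` S \<union> C) = U"
  proof -
    have "range \<phi> + W = GV.span (\<phi> ` S) + W"
    proof (intro equalityI subsetI)
      fix z assume "z \<in> range \<phi> + W"
      then obtain x w where z: "z = \<phi> x + w" "w \<in> W" by (auto simp: set_plus_def)
      have "x \<in> GV.span (S \<union> A)"
        using B by (simp add: S_def Un_absorb2)
      then obtain s a where sa: "x = s + a" "s \<in> GV.span S" "a \<in> \<phi> -` W"
        unfolding GV.span_Un A by blast
      have "z = \<phi> s + (\<phi> a + w)" using z sa GVP.linear_add[OF lin] by (simp add: add.assoc)
      then show "z \<in> GV.span (\<phi> ` S) + W"
        unfolding spanS using sa z GV.subspace_add[OF W] by (blast intro: set_plus_intro)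
    qed (auto simp: set_plus_def spanS)
    then show ?thesis
      unfolding U GV.span_Un C by (auto simp: set_plus_def)
  qed
  obtain D where D: "\<phi> ` S \<union> C \<subseteq> D" "GV.independent D" "GV.span D = UNIV"
    using GV.basis_extension[of "\<phi> ` S \<union> C" UNIV] ind2 GV.subspace_UNIV by blast
  have "quot_dim W = ecard (D - C)"
    using quot_dim_eq_ecard[OF C(2) _ D(2,3)] D by auto
  also have "D - C = (D - (\<phi> ` S \<union> C)) \<union> \<phi> ` S"
    using D disj by auto
  also have "ecard \<dots> = ecard (D - (\<phi> ` S \<union> C)) + ecard (\<phi> ` S)"
    by (rule ecard_Un_disjoint) auto
  also have "ecard (D - (\<phi> ` S \<union> C)) = quot_dim U"
    using quot_dim_eq_ecard[OF spanU D(1) D(2,3)] by simp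
  also have "ecard (\<phi> ` S) = ecard S"
    using ecard_bij_betw[of \<phi> S "\<phi> ` S"] inj_on_subset[OF inj GV.span_superset] by (simp add: bij_betw_def)
  also have "ecard S = quot_dim (\<phi> -` W)"
    using quot_dim_eq_ecard[OF A(2) B(1) B(2,3)] by (simp add: S_def)
  finally show ?thesis .
qed

section \<open>Taylor expansion in two variables\<close>

text \<open>A bidisc rather than a ball, so that all slices in x or in y are discs of the same
  radius.\<close>

definition polydisc :: "real \<Rightarrow> (complex \<times> complex \<Rightarrow> complex) \<Rightarrow> bool" where
  "polydisc r f \<longleftrightarrow> 0 < r \<and> (\<forall>x y. norm x < r \<longrightarrow> norm y < r \<longrightarrow>
     (\<exists>a b. (f has_derivative (\<lambda>(u, v). a * u + b * v)) (at (x, y))))"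

lemma holo_near_0_iff_polydisc: "holo_near_0 f \<longleftrightarrow> (\<exists>r. polydisc r f)"
proof
  assume "holo_near_0 f"
  then obtain e where e: "e > 0"
    "\<And>p. dist p 0 < e \<Longrightarrow> \<exists>a b. (f has_derivative (\<lambda>(u, v). a * u + b * v)) (at p)"
    unfolding holo_near_0_def eventually_nhds_metric by blast
  have "polydisc (e / 2) f"
    unfolding polydisc_def
  proof (intro conjI allI impI)
    fix x y :: complex assume xy: "norm x < e / 2" "norm y < e / 2"
    have "norm (x, y) \<le> norm x + norm y"
      by (rule norm_Pair_le)
    then have "dist (x, y) 0 < e" using xy by simp
    then show "\<exists>a b. (f has_derivative (\<lambda>(u, v). a * u + b * v)) (at (x, y))"
      by (rule e(2))
  qed (use e in simp)
  then show "\<exists>r. polydisc r f" by blast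
next
  assume "\<exists>r. polydisc r f"
  then obtain r where r: "polydisc r f" by blast
  show "holo_near_0 f"
    unfolding holo_near_0_def eventually_nhds_metric
  proof (intro exI[of _ r] conjI allI impI)
    fix p :: "complex \<times> complex" assume "dist p 0 < r"
    then have "norm p < r" by simp
    then have "norm (fst p) < r" "norm (snd p) < r"
      using norm_fst_le[of "fst p" "snd p"] norm_snd_le[of "snd p" "fst p"] by simp_all
    then show "\<exists>a b. (f has_derivative (\<lambda>(u, v). a * u + b * v)) (at p)"
      using r unfolding polydisc_def by (metis prod.collapse)
  qed (use r in \<open>simp add: polydisc_def\<close>)
qed

lemma polydisc_mono: "polydisc r f \<Longrightarrow> 0 < s \<Longrightarrow> s \<le> r \<Longrightarrow> polydisc s f"
  unfolding polydisc_def by (meson less_le_trans)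

lemma polydisc_holomorphic_snd:
  assumes "polydisc r f" "norm x < r"
  shows "(\<lambda>y. f (x, y)) holomorphic_on ball 0 r"
proof (rule holomorphic_on_subset[OF _ subset_refl], subst holomorphic_on_open, simp, intro ballI)
  fix y :: complex assume "y \<in> ball 0 r"
  then obtain a b where d: "(f has_derivative (\<lambda>(u, v). a * u + b * v)) (at (x, y))"
    using assms unfolding polydisc_def by (metis mem_ball_0)
  have "((\<lambda>y. (x, y)) has_derivative (\<lambda>h. (0, h))) (at y)"
    by (auto intro!: derivative_eq_intros)
  from has_derivative_compose[OF this d]
  have "((\<lambda>y. f (x, y)) has_derivative (\<lambda>h. b * h)) (at y)"
    by simp
  then show "\<exists>f'. ((\<lambda>y. f (x, y)) has_field_derivative f') (at y)"
    unfolding has_field_derivative_def by blast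
qed

lemma polydisc_holomorphic_fst:
  assumes "polydisc r f" "norm y < r"
  shows "(\<lambda>x. f (x, y)) holomorphic_on ball 0 r"
proof (rule holomorphic_on_subset[OF _ subset_refl], subst holomorphic_on_open, simp, intro ballI)
  fix x :: complex assume "x \<in> ball 0 r"
  then obtain a b where d: "(f has_derivative (\<lambda>(u, v). a * u + b * v)) (at (x, y))"
    using assms unfolding polydisc_def by (metis mem_ball_0)
  have "((\<lambda>x. (x, y)) has_derivative (\<lambda>h. (h, 0))) (at x)"
    by (auto intro!: derivative_eq_intros)
  from has_derivative_compose[OF this d]
  have "((\<lambda>x. f (x, y)) has_derivative (\<lambda>h. a * h)) (at x)"
    by simp
  then show "\<exists>f'. ((\<lambda>x. f (x, y)) has_field_derivative f') (at x)"
    unfolding has_field_derivative_def by blast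
qed

text \<open>Expanding in y before x matches the order of differentiation in
  \<open>germ_partial\<close>.\<close>

definition ycoeff :: "nat \<Rightarrow> (complex \<times> complex \<Rightarrow> complex) \<Rightarrow> complex \<Rightarrow> complex" where
  "ycoeff j f x = (deriv ^^ j) (\<lambda>y. f (x, y)) 0 / fact j"

lemma ycoeff_sums:
  assumes "polydisc r f" "norm x < r" "norm y < r"
  shows "(\<lambda>j. ycoeff j f x * y ^ j) sums f (x, y)"
  using holomorphic_power_series[OF polydisc_holomorphic_snd[OF assms(1,2)], of y] assms(3)
  by (simp add: ycoeff_def)

lemma polydisc_bounded:
  assumes "polydisc r f" "0 < s" "s < r"
  obtains B where "0 < B" "\<And>x y. norm x \<le> s \<Longrightarrow> norm y \<le> s \<Longrightarrow> norm (f (x, y)) \<le> B"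
proof -
  have "continuous_on (cball 0 s \<times> cball 0 s) f"
  proof (rule continuous_at_imp_continuous_on, rule ballI)
    fix p :: "complex \<times> complex" assume "p \<in> cball 0 s \<times> cball 0 s"
    then obtain a b where "(f has_derivative (\<lambda>(u, v). a * u + b * v)) (at p)"
      using assms unfolding polydisc_def by (cases p) force
    then show "isCont f p" by (rule has_derivative_continuous)
  qed
  then have "compact (f ` (cball 0 s \<times> cball 0 s))"
    by (intro compact_continuous_image compact_Times compact_cball)
  then obtain B where "0 < B" "\<And>z. z \<in> f ` (cball 0 s \<times> cball 0 s) \<Longrightarrow> norm z \<le> B"
    using compact_imp_bounded bounded_pos by metis
  then show ?thesis by (intro that[of B]) auto
qed

lemma ycoeff_bound:
  assumes f: "polydisc r f" "0 < s" "s < r" and x: "norm x \<le> s"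
    and B: "\<And>x y. norm x \<le> s \<Longrightarrow> norm y \<le> s \<Longrightarrow> norm (f (x, y)) \<le> B"
  shows "norm (ycoeff j f x) \<le> B / s ^ j"
proof -
  have h: "(\<lambda>y. f (x, y)) holomorphic_on ball 0 r"
    using polydisc_holomorphic_snd[OF f(1)] x f by simp
  have "norm ((deriv ^^ j) (\<lambda>y. f (x, y)) 0) \<le> fact j * B / s ^ j"
  proof (rule Cauchy_inequality)
    show "(\<lambda>y. f (x, y)) holomorphic_on ball 0 s"
      using h f by (rule_tac holomorphic_on_subset) auto
    show "continuous_on (cball 0 s) (\<lambda>y. f (x, y))"
      using h f by (intro holomorphic_on_imp_continuous_on) (auto intro: holomorphic_on_subset)
  qed (use f x B in auto)
  then show ?thesis
    by (simp add: ycoeff_def norm_divide field_simps)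
qed

text \<open>The coefficient of \<open>y^j\<close> is the locally uniform limit, as \<open>y\<close> tends to 0, of
  \<open>(f(x, y) - \<Sum>k<j. ycoeff k f x * y^k) / y^j\<close>.\<close>

lemma ycoeff_holomorphic:
  assumes f: "polydisc r f" "0 < s" "s < r"
  shows "ycoeff j f holomorphic_on ball 0 s"
proof (induction j rule: less_induct)
  case (less j)
  obtain B where B: "0 < B" "\<And>x y. norm x \<le> s \<Longrightarrow> norm y \<le> s \<Longrightarrow> norm (f (x, y)) \<le> B"
    using polydisc_bounded[OF f] by metis
  \<comment> \<open>A nonzero null sequence; staying within s / 2 makes the tails in y comparable to
    a geometric series of ratio 1/2.\<close>
  define Y where "Y n = complex_of_real (s / (2 * (real n + 1)))" for n
  have Y0: "Y n \<noteq> 0" for n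
    using f by (auto simp: Y_def complex_eq_iff add_eq_0_iff)
  have Yn: "norm (Y n) = s / (2 * (real n + 1))" for n
    using f by (simp add: Y_def norm_divide norm_mult del: of_real_divide of_real_mult of_real_add)
  have Ys: "norm (Y n) \<le> s / 2" for n
    unfolding Yn using f by (intro divide_left_mono) auto
  define g where "g n x = (f (x, Y n) - (\<Sum>k<j. ycoeff k f x * Y n ^ k)) / Y n ^ j" for n x
  \<comment> \<open>The difference is the part of the y-series beyond degree j, divided by
    \<open>Y n ^ j\<close>. Each of its terms keeps a factor \<open>Y n\<close>, whence a bound
    uniform in x.\<close>
  have bound: "norm (g n x - ycoeff j f x) \<le> 2 * B / s ^ Suc j * norm (Y n)" if x: "norm x < s" for n x
  proof -
    have "(\<lambda>k. ycoeff k f x * Y n ^ k) sums f (x, Y n)"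
      using ycoeff_sums[OF f(1), of x "Y n"] x f Ys[of n] by simp
    then have "(\<lambda>k. ycoeff (k + Suc j) f x * Y n ^ (k + Suc j)) sums
        (f (x, Y n) - (\<Sum>k<Suc j. ycoeff k f x * Y n ^ k))"
      by (rule sums_split_initial_segment)
    then have "(\<lambda>k. ycoeff (k + Suc j) f x * Y n ^ (k + Suc j) / Y n ^ j) sums
        ((f (x, Y n) - (\<Sum>k<Suc j. ycoeff k f x * Y n ^ k)) / Y n ^ j)"
      by (rule sums_divide)
    also have "(f (x, Y n) - (\<Sum>k<Suc j. ycoeff k f x * Y n ^ k)) / Y n ^ j = g n x - ycoeff j f x"
      using Y0[of n] by (simp add: g_def field_simps)
    also have "(\<lambda>k. ycoeff (k + Suc j) f x * Y n ^ (k + Suc j) / Y n ^ j) =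
        (\<lambda>k. ycoeff (k + Suc j) f x * Y n ^ Suc k)"
      using Y0[of n] by (simp add: power_add fun_eq_iff)
    finally have sm: "(\<lambda>k. ycoeff (k + Suc j) f x * Y n ^ Suc k) sums (g n x - ycoeff j f x)" .
    have le: "norm (ycoeff (k + Suc j) f x * Y n ^ Suc k) \<le> B / s ^ Suc j * norm (Y n) * (1/2) ^ k" for k
    proof -
      have "norm (ycoeff (k + Suc j) f x * Y n ^ Suc k) \<le> B / s ^ (k + Suc j) * (norm (Y n) * (s/2) ^ k)"
        unfolding norm_mult norm_power power_Suc
        using ycoeff_bound[OF f _ B(2), of x "k + Suc j"] x B f Ys[of n]
        by (intro mult_mono power_mono) auto
      also have "\<dots> = B / s ^ Suc j * norm (Y n) * (1/2) ^ k"
        using f by (simp add: power_add power_divide field_simps)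
      finally show ?thesis .
    qed
    have geo: "(\<lambda>k. B / s ^ Suc j * norm (Y n) * (1/2) ^ k) sums (B / s ^ Suc j * norm (Y n) * 2)"
      using geometric_sums[of "1/2::real"] by (intro sums_mult) simp
    have "norm (g n x - ycoeff j f x) \<le> B / s ^ Suc j * norm (Y n) * 2"
      using norm_suminf_le[OF le sums_summable[OF geo]] sums_unique[OF sm] sums_unique[OF geo] by simp
    then show ?thesis by (simp add: mult_ac)
  qed
  have Ylim: "Y \<longlonglongrightarrow> 0"
  proof (rule tendsto_norm_zero_cancel, unfold Yn)
    show "(\<lambda>n. s / (2 * (real n + 1))) \<longlonglongrightarrow> 0" by real_asymp
  qed
  have "uniform_limit (ball 0 s) g (ycoeff j f) sequentially"
  proof (rule uniform_limitI)
    fix e :: real assume "e > 0"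
    have "(\<lambda>n. 2 * B / s ^ Suc j * norm (Y n)) \<longlonglongrightarrow> 2 * B / s ^ Suc j * 0"
      using tendsto_norm_zero[OF Ylim] by (intro tendsto_mult tendsto_const)
    then have "\<forall>\<^sub>F n in sequentially. 2 * B / s ^ Suc j * norm (Y n) < e"
      using \<open>e > 0\<close> order_tendstoD(2) by force
    then show "\<forall>\<^sub>F n in sequentially. \<forall>x\<in>ball 0 s. dist (g n x) (ycoeff j f x) < e"
      by eventually_elim (auto simp: dist_norm intro: le_less_trans[OF bound])
  qed
  moreover have "g n holomorphic_on ball 0 s" for n
  proof -
    have "(\<lambda>x. f (x, Y n)) holomorphic_on ball 0 s"
      using polydisc_holomorphic_fst[OF f(1), of "Y n"] Ys[of n] f
      by (auto elim!: holomorphic_on_subset)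
    then show ?thesis
      unfolding g_def using less.IH Y0 by (intro holomorphic_intros) auto
  qed
  ultimately show ?case
  proof (rule_tac holomorphic_uniform_sequence[of "ball 0 s" g])
    fix x :: complex assume x: "x \<in> ball 0 s"
    then obtain d where "0 < d" "cball x d \<subseteq> ball 0 s"
      using open_contains_cball open_ball by metis
    then show "\<exists>d>0. cball x d \<subseteq> ball 0 s \<and> uniform_limit (cball x d) g (ycoeff j f) sequentially"
      using \<open>uniform_limit (ball 0 s) g (ycoeff j f) sequentially\<close> uniform_limit_on_subset by blast
  qed auto
qed


text \<open>A \<open>complex fps fps\<close> is a series in \<open>y\<close> over series in \<open>x\<close>: the coefficient of \<open>x^i y^j\<close> in \<open>A\<close>
  is \<open>A $ j $ i\<close>.\<close>

definition convergent_fps2 :: "complex fps fps \<Rightarrow> bool" where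
  "convergent_fps2 A \<longleftrightarrow> (\<exists>C R. 0 < R \<and> (\<forall>i j. norm (A $ j $ i) \<le> C * R ^ (i + j)))"

definition expansion2 :: "(complex \<times> complex \<Rightarrow> complex) \<Rightarrow> complex fps fps" where
  "expansion2 f = Abs_fps (\<lambda>j. fps_expansion (ycoeff j f) 0)"

lemma ycoeff_has_fps_expansion:
  assumes "polydisc r f"
  shows "ycoeff j f has_fps_expansion expansion2 f $ j"
proof -
  have "0 < r / 2" "r / 2 < r" using assms by (auto simp: polydisc_def)
  then have "ycoeff j f holomorphic_on ball 0 (r / 2)"
    using ycoeff_holomorphic[OF assms] by blast
  then have "ycoeff j f analytic_on {0}"
    using \<open>0 < r / 2\<close> by (auto simp: analytic_at intro!: exI[of _ "ball 0 (r / 2)"])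
  then show ?thesis
    by (simp add: expansion2_def analytic_at_imp_has_fps_expansion_0)
qed

lemma expansion2_eqI:
  assumes "\<And>j. ycoeff j f has_fps_expansion A $ j"
  shows "expansion2 f = A"
  using fps_expansion_eqI[OF assms] by (simp add: expansion2_def fps_eq_iff)

text \<open>Cauchy's inequality is applied twice: in y to bound \<open>ycoeff j f\<close>, then in x
  to that function.\<close>

lemma convergent_expansion2:
  assumes "polydisc r f"
  shows "convergent_fps2 (expansion2 f)"
proof -
  define s where "s = r / 2"
  have s: "0 < s" "s < r" using assms by (auto simp: polydisc_def s_def)
  obtain B where B: "0 < B" "\<And>x y. norm x \<le> s \<Longrightarrow> norm y \<le> s \<Longrightarrow> norm (f (x, y)) \<le> B"
    using polydisc_bounded[OF assms s] by metis
  \<comment> \<open>\<open>ycoeff j f\<close> is known to be holomorphic on the open disc of radius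
    s, whereas the second Cauchy estimate needs continuity up to the boundary.\<close>
  define t where "t = s / 2"
  have t: "0 < t" "t < s" using s by (auto simp: t_def)
  have "norm (expansion2 f $ j $ i) \<le> B * (1 / t) ^ (i + j)" for i j
  proof -
    have "norm ((deriv ^^ i) (ycoeff j f) 0) \<le> fact i * (B / s ^ j) / t ^ i"
    proof (rule Cauchy_inequality)
      show "ycoeff j f holomorphic_on ball 0 t"
        using ycoeff_holomorphic[OF assms s] t by (rule_tac holomorphic_on_subset) auto
      show "continuous_on (cball 0 t) (ycoeff j f)"
        using ycoeff_holomorphic[OF assms s] t
        by (intro holomorphic_on_imp_continuous_on holomorphic_on_subset[OF ycoeff_holomorphic[OF assms s]]) auto
      show "norm (ycoeff j f x) \<le> B / s ^ j" if "norm (0 - x) = t" for x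
        using ycoeff_bound[OF assms s _ B(2)] that t by simp
    qed (use t in auto)
    also have "\<dots> \<le> fact i * (B / t ^ j) / t ^ i"
      using B t s by (intro divide_right_mono mult_left_mono divide_left_mono power_mono) auto
    finally show ?thesis
      using t by (simp add: expansion2_def fps_expansion_def norm_divide field_simps power_add)
  qed
  then show ?thesis
    unfolding convergent_fps2_def using t by (intro exI[of _ B] exI[of _ "1 / t"]) auto
qed

lemma expansion2_cong:
  assumes "\<forall>\<^sub>F p in nhds 0. f p = g p"
  shows "expansion2 f = expansion2 g"
proof -
  have "\<forall>\<^sub>F p in nhds 0 \<times>\<^sub>F nhds 0. f p = g p"
    using assms by (simp add: nhds_prod[symmetric] zero_prod_def)
  then have "\<forall>\<^sub>F x in nhds 0. \<forall>\<^sub>F y in nhds 0. f (x, y) = g (x, y)"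
    by (rule eventually_eventually_prod_filter1)
  then have "\<forall>\<^sub>F x in nhds 0. ycoeff j f x = ycoeff j g x" for j
    unfolding ycoeff_def by eventually_elim (metis higher_deriv_cong_ev)
  then have "(deriv ^^ i) (ycoeff j f) 0 = (deriv ^^ i) (ycoeff j g) 0" for i j
    by (rule higher_deriv_cong_ev[OF _ refl])
  then show ?thesis
    by (simp add: expansion2_def fps_eq_iff fps_expansion_def)
qed

text \<open>Near 0 each function is the sum of its series in y, and the coefficients of that series
  are in turn the sums of the coefficient series in x.\<close>

lemma expansion2_inject:
  assumes f: "polydisc r f" and g: "polydisc r g" and eq: "expansion2 f = expansion2 g"
  shows "\<forall>\<^sub>F p in nhds 0. f p = g p"
proof -
  have r: "0 < r" using f by (simp add: polydisc_def)
  have eval: "ycoeff j h x = eval_fps (expansion2 h $ j) x"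
    if "polydisc r h" "norm x < r / 2" for h j x
    using has_fps_expansion_imp_eval_fps_eq[OF ycoeff_has_fps_expansion[OF that(1)] that(2)]
      ycoeff_holomorphic[OF that(1), of "r / 2"] r by simp
  have "f (x, y) = g (x, y)" if "norm x < r / 2" "norm y < r / 2" for x y
    using ycoeff_sums[OF f, of x y] ycoeff_sums[OF g, of x y] that r
      eval[OF f that(1)] eval[OF g that(1)] eq by (auto intro: sums_unique2)
  then have "\<forall>p. dist p 0 < r / 2 \<longrightarrow> f p = g p"
    using le_less_trans[OF norm_fst_le] le_less_trans[OF norm_snd_le]
    by (metis dist_0_norm dist_commute prod.collapse)
  then show ?thesis
    unfolding eventually_nhds_metric using r by (intro exI[of _ "r / 2"]) auto
qed

section \<open>Expansion respects the ring operations\<close>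

lemma expansion2_const: "expansion2 (\<lambda>_. c) = fps_const (fps_const c)"
proof (rule expansion2_eqI)
  fix j
  have "ycoeff j (\<lambda>_. c) = (\<lambda>_. if j = 0 then c else 0)"
    by (auto simp: ycoeff_def fun_eq_iff higher_deriv_const)
  then show "ycoeff j (\<lambda>_. c) has_fps_expansion fps_const (fps_const c) $ j"
    by simp
qed

text \<open>Reading a slice as a formal series in y reduces sums and products of functions to
  uniqueness of one-variable expansions.\<close>

lemma ycoeff_fps_expansion:
  assumes "polydisc r f" "norm x < r"
  shows "(\<lambda>y. f (x, y)) has_fps_expansion Abs_fps (\<lambda>j. ycoeff j f x)"
proof -
  have "(\<lambda>y. f (x, y)) analytic_on {0}"
    using polydisc_holomorphic_snd[OF assms] assms
    by (auto simp: analytic_at polydisc_def intro!: exI[of _ "ball 0 r"])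
  then show ?thesis
    using analytic_at_imp_has_fps_expansion_0 by (simp add: fps_expansion_def ycoeff_def)
qed

lemma ycoeff_mult:
  assumes "polydisc r f" "polydisc r g" "norm x < r"
  shows "ycoeff j (\<lambda>p. f p * g p) x = (\<Sum>k=0..j. ycoeff k f x * ycoeff (j - k) g x)"
  using fps_nth_fps_expansion[OF has_fps_expansion_mult[OF
      ycoeff_fps_expansion[OF assms(1,3)] ycoeff_fps_expansion[OF assms(2,3)]], of j]
  by (simp add: ycoeff_def[of j "\<lambda>p. f p * g p"] fps_mult_nth)

lemma ycoeff_add:
  assumes "polydisc r f" "polydisc r g" "norm x < r"
  shows "ycoeff j (\<lambda>p. f p + g p) x = ycoeff j f x + ycoeff j g x"
  using fps_nth_fps_expansion[OF has_fps_expansion_add[OF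
      ycoeff_fps_expansion[OF assms(1,3)] ycoeff_fps_expansion[OF assms(2,3)]], of j]
  by (simp add: ycoeff_def[of j "\<lambda>p. f p + g p"])

lemma expansion2_mult:
  assumes f: "polydisc r f" and g: "polydisc r g"
  shows "expansion2 (\<lambda>p. f p * g p) = expansion2 f * expansion2 g"
proof (rule expansion2_eqI)
  fix j
  have "\<forall>\<^sub>F x in nhds 0. (\<Sum>k=0..j. ycoeff k f x * ycoeff (j - k) g x) = ycoeff j (\<lambda>p. f p * g p) x"
    unfolding eventually_nhds_metric using f ycoeff_mult[OF f g]
    by (intro exI[of _ r]) (auto simp: polydisc_def)
  moreover have "(\<lambda>x. \<Sum>k=0..j. ycoeff k f x * ycoeff (j - k) g x) has_fps_expansion
      (\<Sum>k=0..j. expansion2 f $ k * expansion2 g $ (j - k))"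
    by (intro has_fps_expansion_sum has_fps_expansion_mult
        ycoeff_has_fps_expansion[OF f] ycoeff_has_fps_expansion[OF g])
  ultimately show "ycoeff j (\<lambda>p. f p * g p) has_fps_expansion (expansion2 f * expansion2 g) $ j"
    unfolding fps_mult_nth by (rule iffD1[OF has_fps_expansion_cong[OF _ refl]])
qed

lemma expansion2_add:
  assumes f: "polydisc r f" and g: "polydisc r g"
  shows "expansion2 (\<lambda>p. f p + g p) = expansion2 f + expansion2 g"
proof (rule expansion2_eqI)
  fix j
  have "\<forall>\<^sub>F x in nhds 0. ycoeff j f x + ycoeff j g x = ycoeff j (\<lambda>p. f p + g p) x"
    unfolding eventually_nhds_metric using f ycoeff_add[OF f g]
    by (intro exI[of _ r]) (auto simp: polydisc_def)
  moreover have "(\<lambda>x. ycoeff j f x + ycoeff j g x) has_fps_expansion (expansion2 f $ j + expansion2 g $ j)"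
    by (intro has_fps_expansion_add ycoeff_has_fps_expansion[OF f] ycoeff_has_fps_expansion[OF g])
  ultimately show "ycoeff j (\<lambda>p. f p + g p) has_fps_expansion (expansion2 f + expansion2 g) $ j"
    unfolding fps_add_nth by (rule iffD1[OF has_fps_expansion_cong[OF _ refl]])
qed

section \<open>Convergent power series in two variables\<close>

lemma geometric_sum_le_2:
  fixes q :: real
  assumes "0 \<le> q" "q \<le> 1/2"
  shows "(\<Sum>k\<le>n. q ^ k) \<le> 2"
proof -
  have "(\<Sum>k\<le>n. q ^ k) \<le> (\<Sum>k\<le>n. (1/2) ^ k)"
    using assms by (intro sum_mono power_mono) auto
  also have "\<dots> = 2 - (1/2) ^ n"
    by (induction n) (auto simp: field_simps)
  also have "\<dots> \<le> 2" by simp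
  finally show ?thesis .
qed

text \<open>The estimate is offered for every rate r above R so that two series can be bounded at
  one common rate.\<close>

lemma convergent_fps2_E:
  assumes "convergent_fps2 A"
  obtains C R where "0 \<le> C" "1 \<le> R" "\<And>i j r. R \<le> r \<Longrightarrow> norm (A $ j $ i) \<le> C * r ^ (i + j)"
proof -
  obtain C R where C: "0 < R" "\<And>i j. norm (A $ j $ i) \<le> C * R ^ (i + j)"
    using assms unfolding convergent_fps2_def by blast
  have "0 \<le> C" using order_trans[OF norm_ge_zero C(2)[of 0 0]] by simp
  show ?thesis
  proof (rule that[of C "max 1 R"])
    fix i j r assume "max 1 R \<le> r"
    then have "R ^ (i + j) \<le> r ^ (i + j)" using C by (intro power_mono) auto
    then show "norm (A $ j $ i) \<le> C * r ^ (i + j)"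
      using C(2)[of j i] mult_left_mono[OF _ \<open>0 \<le> C\<close>] order_trans by blast
  qed (use \<open>0 \<le> C\<close> in auto)
qed

text \<open>Raising the total degree by at most n costs a factor \<open>R ^ n\<close>, because R is
  at least 1.\<close>

lemma convergent_fps2_reindex:
  assumes "convergent_fps2 A"
    and B: "\<And>i j. B $ j $ i = 0 \<or> (\<exists>k l. k + l \<le> i + j + n \<and> B $ j $ i = A $ l $ k)"
  shows "convergent_fps2 B"
proof -
  obtain C R where C: "0 \<le> C" "1 \<le> R" "\<And>i j r. R \<le> r \<Longrightarrow> norm (A $ j $ i) \<le> C * r ^ (i + j)"
    using convergent_fps2_E[OF assms(1)] by metis
  have "norm (B $ j $ i) \<le> C * R ^ n * R ^ (i + j)" for i j
    using B[of j i]
  proof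
    assume "\<exists>k l. k + l \<le> i + j + n \<and> B $ j $ i = A $ l $ k"
    then obtain k l where kl: "k + l \<le> i + j + n" "B $ j $ i = A $ l $ k" by blast
    have "norm (B $ j $ i) \<le> C * R ^ (k + l)" using C kl by simp
    also have "\<dots> \<le> C * R ^ (i + j + n)"
      using kl C by (intro mult_left_mono power_increasing) auto
    finally show ?thesis by (simp add: power_add mult_ac)
  qed (use C in auto)
  then show ?thesis
    unfolding convergent_fps2_def using C by (intro exI[of _ "C * R ^ n"] exI[of _ R]) auto
qed

lemma convergent_fps2_shift:
  assumes "convergent_fps2 A"
  shows "convergent_fps2 (fps_shift n A)"
proof (rule convergent_fps2_reindex[OF assms, where n = n])
  fix i j
  show "fps_shift n A $ j $ i = 0 \<or> (\<exists>k l. k + l \<le> i + j + n \<and> fps_shift n A $ j $ i = A $ l $ k)"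
    by (intro disjI2 exI[of _ i] exI[of _ "j + n"]) simp
qed

text \<open>\<open>A $ 0\<close> is the restriction to y = 0. It is used with n = 0 for this
  restriction itself and with n = 1 for its quotient by x.\<close>

lemma convergent_fps2_const_shift:
  assumes "convergent_fps2 A"
  shows "convergent_fps2 (fps_const (fps_shift n (A $ 0)))"
proof (rule convergent_fps2_reindex[OF assms, where n = n])
  fix i j
  show "fps_const (fps_shift n (A $ 0)) $ j $ i = 0 \<or>
      (\<exists>k l. k + l \<le> i + j + n \<and> fps_const (fps_shift n (A $ 0)) $ j $ i = A $ l $ k)"
  proof (cases "j = 0")
    case True
    then show ?thesis by (intro disjI2 exI[of _ "i + n"] exI[of _ 0]) simp
  qed simp
qed

text \<open>Solving \<open>A = W * q\<close> for the
  coefficient of \<open>x^i y^j\<close> in \<open>q\<close> gives a recursion, lexicographic in \<open>(j, i)\<close>, along which a bound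
  \<open>C R^j S^i\<close> propagates once \<open>S\<close> and then \<open>R\<close> are large enough.\<close>

lemma convergent_fps2_quotient:
  assumes A: "convergent_fps2 (W * q)" and W: "convergent_fps2 W" and W0: "W $ 0 \<noteq> 0"
  shows "convergent_fps2 q"
proof -
  obtain F \<rho>1 where F: "0 \<le> F" "1 \<le> \<rho>1" "\<And>i j r. \<rho>1 \<le> r \<Longrightarrow> norm ((W * q) $ j $ i) \<le> F * r ^ (i + j)"
    using convergent_fps2_E[OF A] by metis
  obtain D \<rho>2 where D: "0 \<le> D" "1 \<le> \<rho>2" "\<And>i j r. \<rho>2 \<le> r \<Longrightarrow> norm (W $ j $ i) \<le> D * r ^ (i + j)"
    using convergent_fps2_E[OF W] by metis
  define \<rho> where "\<rho> = max \<rho>1 \<rho>2"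
  have \<rho>: "1 \<le> \<rho>" "\<rho>1 \<le> \<rho>" "\<rho>2 \<le> \<rho>" using F D by (auto simp: \<rho>_def)
  define m where "m = subdegree (W $ 0)"
  define w where "w = W $ 0 $ m"
  have w: "w \<noteq> 0" "\<And>a. a < m \<Longrightarrow> W $ 0 $ a = 0"
    using nth_subdegree_nonzero[OF W0] nth_less_subdegree_zero by (auto simp only: w_def m_def)
  \<comment> \<open>The bounds 2 \<rho> \<le> S and 2 \<rho> \<le> R keep the geometric ratios at
    most 1/2, so each geometric sum is at most 2. The rest splits |w| times the target bound: C
    allots 1/2 to the coefficient of W q, S allots 1/4 to the higher terms of W(x, 0) (8 = 4 * 2),
    and R allots 1/4 to the terms of W with positive y-degree (16 = 4 * 2 * 2, for two geometric
    sums). R depends on S because the last terms bring in \<open>S ^ m\<close>.\<close>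
  define S where "S = max (2 * \<rho>) (8 * D * \<rho> ^ Suc m / norm w)"
  define R where "R = max (max (2 * \<rho>) S) (16 * D * \<rho> * S ^ m / norm w)"
  define C where "C = 2 * F * \<rho> ^ m / norm w"
  have S: "2 * \<rho> \<le> S" "8 * D * \<rho> ^ Suc m \<le> S * norm w" "0 < S" "\<rho> \<le> S"
  proof -
    have "8 * D * \<rho> ^ Suc m / norm w \<le> S" "2 * \<rho> \<le> S" by (simp_all add: S_def)
    then show "2 * \<rho> \<le> S" "8 * D * \<rho> ^ Suc m \<le> S * norm w" "0 < S" "\<rho> \<le> S"
      using w(1) \<rho>(1) by (simp_all add: pos_divide_le_eq)
  qed
  have R: "2 * \<rho> \<le> R" "16 * D * \<rho> * S ^ m \<le> R * norm w" "0 < R" "\<rho> \<le> R" "S \<le> R"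
  proof -
    have "16 * D * \<rho> * S ^ m / norm w \<le> R" "2 * \<rho> \<le> R" "S \<le> R" by (simp_all add: R_def)
    then show "2 * \<rho> \<le> R" "16 * D * \<rho> * S ^ m \<le> R * norm w" "0 < R" "\<rho> \<le> R" "S \<le> R"
      using w(1) \<rho>(1) by (simp_all add: pos_divide_le_eq)
  qed
  have C: "0 \<le> C" "F * \<rho> ^ m = C * norm w / 2"
    using F \<rho> w by (auto simp: C_def field_simps)
  have main: "norm (q $ j $ i) \<le> C * R ^ j * S ^ i" for j i
  proof (induction j arbitrary: i rule: less_induct)
    case (less j)
    note IHj = less.IH
    show ?case
    proof (induction i rule: less_induct)
      case (less i)
      \<comment> \<open>At x-degree i + m the unknown \<open>q $ j $ i\<close> meets w, the lowest
        coefficient of W(x, 0). The terms with b > 0 involve x-degrees of q up to i + m, beyond i,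
        so the outer induction runs over j and covers all i.\<close>
      have "(W * q) $ j $ (i + m) = (\<Sum>b=0..j. \<Sum>a=0..i + m. W $ b $ a * q $ (j - b) $ (i + m - a))"
        by (simp add: fps_mult_nth fps_sum_nth)
      also have "\<dots> = (\<Sum>a=0..i + m. W $ 0 $ a * q $ j $ (i + m - a)) +
          (\<Sum>b=1..j. \<Sum>a=0..i + m. W $ b $ a * q $ (j - b) $ (i + m - a))"
        by (simp add: sum.atLeast_Suc_atMost)
      also have "(\<Sum>a=0..i + m. W $ 0 $ a * q $ j $ (i + m - a)) =
          (\<Sum>a=m..i + m. W $ 0 $ a * q $ j $ (i + m - a))"
        using w(2) by (intro sum.mono_neutral_right) auto
      also have "\<dots> = w * q $ j $ i + (\<Sum>a=Suc m..i + m. W $ 0 $ a * q $ j $ (i + m - a))"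
        by (subst sum.atLeast_Suc_atMost) (auto simp: w_def)
      finally have eq: "w * q $ j $ i = (W * q) $ j $ (i + m)
          - (\<Sum>a=Suc m..i + m. W $ 0 $ a * q $ j $ (i + m - a))
          - (\<Sum>b=1..j. \<Sum>a=0..i + m. W $ b $ a * q $ (j - b) $ (i + m - a))"
        by (simp add: algebra_simps)
      define T where "T = C * R ^ j * S ^ i"
      have T: "0 \<le> T" using C R S by (simp add: T_def)
      have b1: "norm ((W * q) $ j $ (i + m)) \<le> norm w / 2 * T"
      proof -
        have "norm ((W * q) $ j $ (i + m)) \<le> F * (\<rho> ^ m * \<rho> ^ j * \<rho> ^ i)"
          using F(3)[OF \<rho>(2), of j "i + m"] by (simp add: power_add mult_ac)
        also have "\<dots> \<le> F * (\<rho> ^ m * R ^ j * S ^ i)"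
          using F \<rho> R S by (intro mult_left_mono mult_mono power_mono) auto
        also have "\<dots> = norm w / 2 * T"
          using C(2) by (simp add: T_def mult_ac)
        finally show ?thesis .
      qed
      have b2: "norm (\<Sum>a=Suc m..i + m. W $ 0 $ a * q $ j $ (i + m - a)) \<le> norm w / 4 * T"
      proof -
        have "norm (\<Sum>a=Suc m..i + m. W $ 0 $ a * q $ j $ (i + m - a)) \<le>
            (\<Sum>a=Suc m..i + m. D * \<rho> ^ Suc m / S * T * (\<rho> / S) ^ (a - Suc m))"
        proof (rule sum_norm_le)
          fix a assume a: "a \<in> {Suc m..i + m}"
          then obtain c where c: "a = Suc m + c" "Suc c \<le> i"
            by (metis add.commute add_Suc atLeastAtMost_iff le_Suc_ex nat_add_left_cancel_le)
          then obtain d where d: "i = Suc c + d" using le_Suc_ex by blast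
          have "norm (W $ 0 $ a * q $ j $ (i + m - a)) \<le> (D * \<rho> ^ a) * (C * R ^ j * S ^ (i + m - a))"
            unfolding norm_mult using D(3)[OF \<rho>(3), of 0 a] less.IH[of "i + m - a"] c D \<rho>
            by (intro mult_mono) auto
          also have "\<dots> = D * \<rho> ^ Suc m / S * T * (\<rho> / S) ^ (a - Suc m)"
            using S by (simp add: c d T_def power_add power_divide field_simps)
          finally show "norm (W $ 0 $ a * q $ j $ (i + m - a)) \<le> D * \<rho> ^ Suc m / S * T * (\<rho> / S) ^ (a - Suc m)" .
        qed
        also have "\<dots> = D * \<rho> ^ Suc m / S * T * (\<Sum>a=Suc m..i + m. (\<rho> / S) ^ (a - Suc m))"
          by (simp add: sum_distrib_left)
        also have "\<dots> \<le> D * \<rho> ^ Suc m / S * T * (\<Sum>k\<le>i. (\<rho> / S) ^ k)"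
          using D \<rho> S T by (intro mult_left_mono sum_le_included[where i = "\<lambda>k. k + Suc m"])
            (auto intro!: bexI[of _ "_ - Suc m"])
        also have "\<dots> \<le> D * \<rho> ^ Suc m / S * T * 2"
          using D \<rho> S T by (intro mult_left_mono geometric_sum_le_2) (auto simp: field_simps)
        also have "\<dots> = (8 * D * \<rho> ^ Suc m) / S / 4 * T"
          by simp
        also have "\<dots> \<le> norm w / 4 * T"
          using S T by (intro mult_right_mono divide_right_mono) (auto simp: field_simps)
        finally show ?thesis .
      qed
      have b3: "norm (\<Sum>b=1..j. \<Sum>a=0..i + m. W $ b $ a * q $ (j - b) $ (i + m - a)) \<le> norm w / 4 * T"
      proof -
        have "norm (\<Sum>b=1..j. \<Sum>a=0..i + m. W $ b $ a * q $ (j - b) $ (i + m - a)) \<le>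
            (\<Sum>b=1..j. D * \<rho> / R * S ^ m * T * 2 * (\<rho> / R) ^ (b - 1))"
        proof (rule sum_norm_le)
          fix b assume b: "b \<in> {1..j}"
          then obtain c where c: "b = Suc c" by (cases b) auto
          with b have "Suc c \<le> j" by simp
          then obtain d where d: "j = Suc c + d" using le_Suc_ex by blast
          have "norm (\<Sum>a=0..i + m. W $ b $ a * q $ (j - b) $ (i + m - a)) \<le>
              (\<Sum>a=0..i + m. D * \<rho> / R * S ^ m * T * (\<rho> / R) ^ c * (\<rho> / S) ^ a)"
          proof (rule sum_norm_le)
            fix a assume "a \<in> {0..i + m}"
            then obtain e where e: "i + m = a + e" using le_Suc_ex by auto
            have SS: "S ^ i * S ^ m = S ^ a * S ^ e" using e by (simp flip: power_add)
            have "norm (W $ b $ a * q $ (j - b) $ (i + m - a)) \<le> (D * \<rho> ^ (a + b)) * (C * R ^ d * S ^ e)"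
              unfolding norm_mult using D(3)[OF \<rho>(3), of b a] IHj[of d e] D \<rho> c d e
              by (intro mult_mono) auto
            also have "\<dots> = D * \<rho> / R * (C * R ^ j * (S ^ a * S ^ e)) * (\<rho> / R) ^ c * (\<rho> / S) ^ a"
              using S R by (simp add: c d power_add power_divide field_simps)
            also have "\<dots> = D * \<rho> / R * S ^ m * T * (\<rho> / R) ^ c * (\<rho> / S) ^ a"
              unfolding SS[symmetric] T_def by (simp add: mult_ac)
            finally show "norm (W $ b $ a * q $ (j - b) $ (i + m - a)) \<le>
                D * \<rho> / R * S ^ m * T * (\<rho> / R) ^ c * (\<rho> / S) ^ a" .
          qed
          also have "\<dots> = D * \<rho> / R * S ^ m * T * (\<rho> / R) ^ c * (\<Sum>a\<le>i + m. (\<rho> / S) ^ a)"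
            by (simp add: sum_distrib_left atLeast0AtMost)
          also have "\<dots> \<le> D * \<rho> / R * S ^ m * T * (\<rho> / R) ^ c * 2"
            using D \<rho> R S T by (intro mult_left_mono geometric_sum_le_2) (auto simp: field_simps)
          finally show "norm (\<Sum>a=0..i + m. W $ b $ a * q $ (j - b) $ (i + m - a)) \<le>
              D * \<rho> / R * S ^ m * T * 2 * (\<rho> / R) ^ (b - 1)"
            by (simp add: c mult_ac)
        qed
        also have "\<dots> = D * \<rho> / R * S ^ m * T * 2 * (\<Sum>b=1..j. (\<rho> / R) ^ (b - 1))"
          by (simp add: sum_distrib_left)
        also have "\<dots> \<le> D * \<rho> / R * S ^ m * T * 2 * (\<Sum>k\<le>j. (\<rho> / R) ^ k)"
          using D \<rho> R S T by (intro mult_left_mono sum_le_included[where i = Suc])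
            (auto intro!: bexI[of _ "_ - 1"])
        also have "\<dots> \<le> D * \<rho> / R * S ^ m * T * 2 * 2"
          using D \<rho> R S T by (intro mult_left_mono geometric_sum_le_2) (auto simp: field_simps)
        also have "\<dots> = (16 * D * \<rho> * S ^ m) / R / 4 * T"
          by simp
        also have "\<dots> \<le> norm w / 4 * T"
          using R T by (intro mult_right_mono divide_right_mono) (auto simp: field_simps)
        finally show ?thesis .
      qed
      have "norm w * norm (q $ j $ i) \<le> norm w / 2 * T + norm w / 4 * T + norm w / 4 * T"
        unfolding norm_mult[symmetric] eq
        using b1 b2 b3 by (intro order_trans[OF norm_triangle_ineq4] add_mono) auto
      also have "\<dots> = norm w * T" by (simp add: algebra_simps)
      finally show ?case using w by (simp add: T_def)
    qed
  qed
  have "norm (q $ j $ i) \<le> C * R ^ (i + j)" for i j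
  proof -
    have "C * R ^ j * S ^ i \<le> C * R ^ j * R ^ i"
      using C R S by (intro mult_left_mono power_mono) auto
    then show ?thesis using main[of j i] by (simp add: power_add mult_ac)
  qed
  then show ?thesis
    unfolding convergent_fps2_def using R by (intro exI[of _ C] exI[of _ R]) auto
qed

text \<open>With n = 0 the second part bounds the sum itself by 2 * K.\<close>

lemma geometric_tail_bound:
  fixes a :: "nat \<Rightarrow> complex"
  assumes a: "\<And>j. norm (a j) \<le> K * (1/2) ^ j"
  shows "summable a" "norm ((\<Sum>j<n. a j) - suminf a) \<le> 2 * K * (1/2) ^ n"
proof -
  have geo: "(\<lambda>k. K * (1/2) ^ n * (1/2) ^ k) sums (K * (1/2) ^ n * 2)" for n
    using geometric_sums[of "1/2::real"] by (intro sums_mult) simp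
  show sm: "summable a"
  proof (rule summable_comparison_test'[where N = 0])
    show "summable (\<lambda>k. K * (1/2) ^ k)"
      using sums_summable[OF geo[of 0]] by simp
  qed (rule a)
  have "norm (suminf (\<lambda>k. a (k + n))) \<le> suminf (\<lambda>k. K * (1/2) ^ n * (1/2) ^ k)"
    using a[of "_ + n"] by (intro norm_suminf_le sums_summable[OF geo]) (simp add: power_add mult_ac)
  then have "norm (suminf (\<lambda>k. a (k + n))) \<le> 2 * K * (1/2) ^ n"
    unfolding sums_unique[OF geo[of n], symmetric] by (simp add: mult_ac)
  then show "norm ((\<Sum>j<n. a j) - suminf a) \<le> 2 * K * (1/2) ^ n"
    unfolding suminf_minus_initial_segment[OF sm] by (simp only: norm_minus_commute)
qed

text \<open>Summing in x first gives holomorphic functions \<open>D j\<close>. The series of D j(x)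
  y^j is then differentiated term by term: the series of derivatives converges uniformly on a
  bidisc, and its sum is again complex linear.\<close>

lemma convergent_fps2_realize:
  assumes "convergent_fps2 A"
  obtains r f where "polydisc r f" "expansion2 f = A"
proof -
  obtain C R where C: "0 \<le> C" "1 \<le> R" "\<And>i j r. R \<le> r \<Longrightarrow> norm (A $ j $ i) \<le> C * r ^ (i + j)"
    using convergent_fps2_E[OF assms] by metis
  \<comment> \<open>On the disc of radius 2 * r the x-series decay like (1/2)^i. A point with |x| <
    r then has room for a circle of radius r in the Cauchy estimate of \<open>deriv (D j)\<close>,
    and for |y| < r the size of R^j y^j is at most (1/4)^j.\<close>
  define r where "r = 1 / (4 * R)"
  have r: "0 < r" "R * r = 1 / 4" using C by (auto simp: r_def)
  define D where "D j x = (\<Sum>i. A $ j $ i * x ^ i)" for j x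
  have term_bound: "norm (A $ j $ i * x ^ i) \<le> C * R ^ j * (1/2) ^ i" if "norm x < 2 * r" for i j x
  proof -
    have "norm (A $ j $ i * x ^ i) \<le> C * R ^ (i + j) * (2 * r) ^ i"
      unfolding norm_mult norm_power using C that by (intro mult_mono power_mono) auto
    also have "\<dots> = C * R ^ j * (2 * (R * r)) ^ i"
      by (simp add: power_add power_mult_distrib)
    finally show ?thesis using r by simp
  qed
  have D_sums: "(\<lambda>i. A $ j $ i * x ^ i) sums D j x" if "norm x < 2 * r" for j x
    unfolding D_def using geometric_tail_bound(1)[OF term_bound[OF that]] by (rule summable_sums)
  have D_bound: "norm (D j x) \<le> 2 * C * R ^ j" if "norm x < 2 * r" for j x
    using geometric_tail_bound(2)[OF term_bound[OF that], where n = 0] by (simp add: D_def mult_ac)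
  have D_holo: "D j holomorphic_on ball 0 (2 * r)" for j
    by (rule power_series_holomorphic[where a = "\<lambda>i. A $ j $ i"]) (use D_sums in auto)
  have D'_bound: "norm (deriv (D j) x) \<le> 2 * C * R ^ j / r" if "norm x < r" for j x
  proof -
    have sub: "cball x r \<subseteq> ball 0 (2 * r)"
    proof
      fix z assume "z \<in> cball x r"
      then show "z \<in> ball 0 (2 * r)"
        using that norm_triangle_sub[of z x] by (simp add: dist_norm norm_minus_commute)
    qed
    have "norm ((deriv ^^ 1) (D j) x) \<le> fact 1 * (2 * C * R ^ j) / r ^ 1"
    proof (rule Cauchy_inequality)
      show "D j holomorphic_on ball x r"
        using D_holo sub ball_subset_cball by (blast intro: holomorphic_on_subset)
      show "continuous_on (cball x r) (D j)"
        using D_holo sub holomorphic_on_imp_continuous_on holomorphic_on_subset by blast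
      show "norm (D j z) \<le> 2 * C * R ^ j" if "norm (x - z) = r" for z
        using sub that by (intro D_bound) (auto simp: dist_norm subset_iff)
    qed (use r in auto)
    then show ?thesis by simp
  qed
  define S :: "(complex \<times> complex) set" where "S = ball 0 r \<times> ball 0 r"
  \<comment> \<open>The x- and y-derivatives of the j-th term. At j = 0 the factor
    \<open>of_nat j\<close> yields the correct value 0 in spite of the truncated exponent.\<close>
  define \<alpha> where "\<alpha> j p = deriv (D j) (fst p) * snd p ^ j" for j p
  define \<beta> where "\<beta> j p = D j (fst p) * (of_nat j * snd p ^ (j - 1))" for j p
  \<comment> \<open>For \<alpha> the factor 1 / r comes from the Cauchy estimate, for \<beta> from
    r^(j - 1) = r^j / r.\<close>
  define K where "K = 2 * C / r"
  have K: "0 \<le> K" using C r by (simp add: K_def)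
  have Rr: "R ^ j * r ^ j = (1/4) ^ j" for j
    using r(2) by (metis power_mult_distrib)
  have \<alpha>_bound: "norm (\<alpha> j p) \<le> K * (1/2) ^ j" if "p \<in> S" for j p
  proof -
    have "norm (\<alpha> j p) \<le> 2 * C * R ^ j / r * r ^ j"
      unfolding \<alpha>_def norm_mult norm_power using that C r D'_bound[of "fst p" j]
      by (intro mult_mono power_mono) (auto simp: S_def)
    also have "\<dots> = K * (1/4) ^ j" using Rr[of j] by (simp add: K_def mult.assoc)
    also have "\<dots> \<le> K * (1/2) ^ j"
      using K by (intro mult_left_mono power_mono) auto
    finally show ?thesis .
  qed
  have \<beta>_bound: "norm (\<beta> j p) \<le> K * (1/2) ^ j" if "p \<in> S" for j p
  proof (cases j)
    case (Suc k)
    have "norm (\<beta> j p) \<le> 2 * C * R ^ j * (real j * r ^ k)"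
      unfolding \<beta>_def norm_mult norm_power norm_of_nat using that C r D_bound[of "fst p" j]
      by (intro mult_mono) (auto simp: S_def Suc intro!: power_mono)
    also have "\<dots> = K * (real j * (1/4) ^ j)"
      unfolding Rr[of j, symmetric] using r by (simp add: K_def Suc)
    \<comment> \<open>Part of the decay (1/4)^j absorbs the factor j.\<close>
    also have "real j * (1/4) ^ j \<le> 2 ^ j * (1/4) ^ j"
      by (intro mult_right_mono) auto
    also have "2 ^ j * (1/4) ^ j = (1/2::real) ^ j"
      by (simp flip: power_mult_distrib)
    finally show ?thesis using K by (simp add: mult_left_mono)
  qed (use K in \<open>simp add: \<beta>_def\<close>)
  have y_bound: "norm (D j x * y ^ j) \<le> 2 * C * (1/2) ^ j" if "norm x < r" "norm y < r" for j x y
  proof -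
    have "norm (D j x * y ^ j) \<le> 2 * C * R ^ j * r ^ j"
      unfolding norm_mult norm_power using that C r D_bound[of x j] by (intro mult_mono power_mono) auto
    also have "\<dots> = 2 * C * (1/4) ^ j" using Rr[of j] by (simp add: mult.assoc)
    also have "\<dots> \<le> 2 * C * (1/2) ^ j"
      using C by (intro mult_left_mono power_mono) auto
    finally show ?thesis .
  qed
  define p0 :: "complex \<times> complex" where "p0 = (0, 0)"
  have S: "convex S" "open S" "p0 \<in> S"
    using r by (auto simp: S_def p0_def intro!: convex_Times open_Times)
  have "\<exists>f. \<forall>p\<in>S. (\<lambda>j. D j (fst p) * snd p ^ j) sums f p \<and>
      (f has_derivative (\<lambda>h. (\<Sum>j. \<alpha> j p) * fst h + (\<Sum>j. \<beta> j p) * snd h)) (at p within S)"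
  proof (rule has_derivative_series[OF S(1) _ _ S(3)])
    fix j :: nat and p assume p: "p \<in> S"
    have "(D j has_field_derivative deriv (D j) (fst p)) (at (fst p))"
      using p r D_holo[of j] by (intro holomorphic_derivI[of _ "ball 0 (2 * r)"]) (auto simp: S_def)
    then have "((\<lambda>p. D j (fst p)) has_derivative (\<lambda>h. deriv (D j) (fst p) * fst h)) (at p within S)"
      unfolding has_field_derivative_def
      by (rule has_derivative_compose[OF has_derivative_fst[OF has_derivative_ident]])
    moreover have "((\<lambda>p. snd p ^ j) has_derivative (\<lambda>h. of_nat j * snd h * snd p ^ (j - 1))) (at p within S)"
      by (rule has_derivative_power[OF has_derivative_snd[OF has_derivative_ident]])
    ultimately show "((\<lambda>p. D j (fst p) * snd p ^ j) has_derivative (\<lambda>h. \<alpha> j p * fst h + \<beta> j p * snd h)) (at p within S)"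
      by (rule has_derivative_eq_rhs[OF has_derivative_mult]) (auto simp: \<alpha>_def \<beta>_def algebra_simps fun_eq_iff)
  next
    fix e :: real assume e: "0 < e"
    have "(\<lambda>n. 4 * K * (1/2) ^ n) \<longlonglongrightarrow> 4 * K * 0"
      by (intro tendsto_intros LIMSEQ_power_zero) auto
    then have "\<forall>\<^sub>F n in sequentially. 4 * K * (1/2) ^ n < e"
      using e order_tendstoD(2) by force
    then show "\<forall>\<^sub>F n in sequentially. \<forall>p\<in>S. \<forall>h. norm ((\<Sum>j<n. \<alpha> j p * fst h + \<beta> j p * snd h)
        - ((\<Sum>j. \<alpha> j p) * fst h + (\<Sum>j. \<beta> j p) * snd h)) \<le> e * norm h"
    proof (eventually_elim, intro ballI allI)
      fix n p and h :: "complex \<times> complex" assume n: "4 * K * (1/2) ^ n < e" and p: "p \<in> S"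
      have "(\<Sum>j<n. \<alpha> j p * fst h + \<beta> j p * snd h) - ((\<Sum>j. \<alpha> j p) * fst h + (\<Sum>j. \<beta> j p) * snd h)
          = ((\<Sum>j<n. \<alpha> j p) - (\<Sum>j. \<alpha> j p)) * fst h + ((\<Sum>j<n. \<beta> j p) - (\<Sum>j. \<beta> j p)) * snd h"
        by (simp add: sum.distrib left_diff_distrib flip: sum_distrib_right)
      also have "norm \<dots> \<le> 2 * K * (1/2) ^ n * norm h + 2 * K * (1/2) ^ n * norm h"
        using geometric_tail_bound(2)[OF \<alpha>_bound[OF p], where n = n] geometric_tail_bound(2)[OF \<beta>_bound[OF p], where n = n]
          norm_fst_le[of "fst h" "snd h"] norm_snd_le[of "snd h" "fst h"] K
        by (intro norm_triangle_le add_mono) (auto simp: norm_mult intro!: mult_mono)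
      also have "\<dots> = 4 * K * (1/2) ^ n * norm h" by simp
      also have "\<dots> \<le> e * norm h" using n by (intro mult_right_mono) auto
      finally show "norm ((\<Sum>j<n. \<alpha> j p * fst h + \<beta> j p * snd h)
        - ((\<Sum>j. \<alpha> j p) * fst h + (\<Sum>j. \<beta> j p) * snd h)) \<le> e * norm h" .
    qed
  next
    have "summable (\<lambda>j. D j (fst p0) * snd p0 ^ j)"
      using geometric_tail_bound(1)[OF y_bound[of 0 0]] r by (simp add: p0_def)
    then show "(\<lambda>j. D j (fst p0) * snd p0 ^ j) sums (\<Sum>j. D j (fst p0) * snd p0 ^ j)"
      by (rule summable_sums)
  qed
  then obtain f where f0: "\<forall>p\<in>S. (\<lambda>j. D j (fst p) * snd p ^ j) sums f p \<and>
      (f has_derivative (\<lambda>h. (\<Sum>j. \<alpha> j p) * fst h + (\<Sum>j. \<beta> j p) * snd h)) (at p within S)" ..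
  have f: "(\<lambda>j. D j (fst p) * snd p ^ j) sums f p"
    "(f has_derivative (\<lambda>h. (\<Sum>j. \<alpha> j p) * fst h + (\<Sum>j. \<beta> j p) * snd h)) (at p)"
    if "p \<in> S" for p
    using bspec[OF f0 that] unfolding at_within_open[OF that S(2)] by blast+
  have pf: "polydisc r f"
    unfolding polydisc_def
  proof (intro conjI allI impI r(1))
    fix x y :: complex assume "norm x < r" "norm y < r"
    then have "(f has_derivative (\<lambda>h. (\<Sum>j. \<alpha> j (x, y)) * fst h + (\<Sum>j. \<beta> j (x, y)) * snd h)) (at (x, y))"
      by (intro f(2)) (auto simp: S_def)
    then show "\<exists>a b. (f has_derivative (\<lambda>(u, v). a * u + b * v)) (at (x, y))"
      by (auto simp: case_prod_unfold)
  qed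
  have yc: "D j x = ycoeff j f x" if x: "norm x < r" for x j
  proof -
    have "(\<lambda>y. f (x, y)) has_fps_expansion Abs_fps (\<lambda>j. D j x)"
      using f(1)[of "(x, _)"] x r unfolding eventually_nhds_metric
      by (intro has_fps_expansionI) (auto simp: S_def eventually_nhds_metric)
    from fps_nth_fps_expansion[OF this] show ?thesis by (simp add: ycoeff_def)
  qed
  have "ycoeff j f has_fps_expansion A $ j" for j
  proof (rule has_fps_expansionI)
    show "\<forall>\<^sub>F x in nhds 0. (\<lambda>i. A $ j $ i * x ^ i) sums ycoeff j f x"
      unfolding eventually_nhds_metric using r D_sums yc
      by (intro exI[of _ r]) (metis dist_0_norm dist_commute mult_2 add_strict_increasing less_imp_le)
  qed
  then show ?thesis
    using that[OF pf] expansion2_eqI by blast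
qed

section \<open>The ring of germs as a ring of power series\<close>

lift_definition germ_expansion :: "germ2 \<Rightarrow> complex fps fps" is expansion2
  by (simp add: germ_eq_def expansion2_cong)

lemma polydisc_common:
  assumes "germ_eq f f" "germ_eq g g"
  obtains r where "polydisc r f" "polydisc r g"
proof -
  obtain r s where "polydisc r f" "polydisc s g"
    using assms by (auto simp: germ_eq_def holo_near_0_iff_polydisc)
  then show ?thesis
    by (intro that[of "min r s"]) (auto intro!: polydisc_mono simp: polydisc_def)
qed

lemma germ_expansion_mult: "germ_expansion (a * b) = germ_expansion a * germ_expansion b"
  by transfer (metis polydisc_common expansion2_mult)

lemma germ_expansion_add: "germ_expansion (a + b) = germ_expansion a + germ_expansion b"
  by transfer (metis polydisc_common expansion2_add)

lemma germ_expansion_0: "germ_expansion 0 = 0"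
  by transfer (simp add: expansion2_const)

lemma germ_expansion_1: "germ_expansion 1 = 1"
  by transfer (simp add: expansion2_const)

lemma germ_expansion_diff: "germ_expansion (a - b) = germ_expansion a - germ_expansion b"
  using germ_expansion_add[of "a - b" b] by (simp add: eq_diff_eq)

lemmas germ_expansion_simps = germ_expansion_mult germ_expansion_add germ_expansion_0
  germ_expansion_1 germ_expansion_diff

lemma germ_expansion_inject: "germ_expansion a = germ_expansion b \<longleftrightarrow> a = b"
proof
  show "germ_expansion a = germ_expansion b \<Longrightarrow> a = b"
  proof transfer
    fix f g assume *: "germ_eq f f" "germ_eq g g" "expansion2 f = expansion2 g"
    then obtain r where "polydisc r f" "polydisc r g" using polydisc_common by metis
    then show "germ_eq f g" using * expansion2_inject by (simp add: germ_eq_def)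
  qed
qed simp

lemma convergent_germ_expansion: "convergent_fps2 (germ_expansion g)"
  by transfer (metis polydisc_common convergent_expansion2)

lemma germ_expansion_surj:
  assumes "convergent_fps2 A"
  obtains g where "germ_expansion g = A"
proof -
  obtain r f where f: "polydisc r f" "expansion2 f = A"
    using convergent_fps2_realize[OF assms] by metis
  then have "germ_eq f f" by (auto simp: germ_eq_def holo_near_0_iff_polydisc)
  then have "germ_expansion (abs_germ2 f) = A"
    using f by (simp add: germ_expansion.abs_eq)
  then show ?thesis by (rule that)
qed

lemma germ_at_0_expansion: "germ_at_0 g = germ_expansion g $ 0 $ 0"
  by transfer (simp add: expansion2_def fps_expansion_def ycoeff_def zero_prod_def)

lemma germ_partial_expansion: "germ_partial i j g = fact i * fact j * (germ_expansion g $ j $ i)"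
proof transfer
  fix i j and f assume "germ_eq f f"
  then obtain r where r: "polydisc r f" using polydisc_common by metis
  then have h: "ycoeff j f holomorphic_on ball 0 (r / 2)" "0 < r"
    using ycoeff_holomorphic[of r f "r / 2" j] by (auto simp: polydisc_def)
  have "(\<lambda>x. (deriv ^^ j) (\<lambda>y. f (x, y)) 0) = (\<lambda>x. fact j * ycoeff j f x)"
    by (simp add: ycoeff_def)
  then have "(deriv ^^ i) (\<lambda>x. (deriv ^^ j) (\<lambda>y. f (x, y)) 0) 0 = fact j * (deriv ^^ i) (ycoeff j f) 0"
    using higher_deriv_cmult[OF h(1), of 0 i "fact j"] h(2) by simp
  then show "(deriv ^^ i) (\<lambda>x. (deriv ^^ j) (\<lambda>y. f (x, y)) 0) 0 = fact i * fact j * (expansion2 f $ j $ i)"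
    by (simp add: expansion2_def fps_expansion_def)
qed

text \<open>The expansion embeds germs into power series over power series, which have no zero
  divisors.\<close>

instance germ2 :: idom
proof
  fix a b :: germ2 assume "a \<noteq> 0" "b \<noteq> 0"
  then show "a * b \<noteq> 0"
    unfolding germ_expansion_inject[symmetric] germ_expansion_simps by simp
qed

section \<open>Order of vanishing\<close>

text \<open>A lower bound for the order instead of the order itself, so that the zero series, of
  infinite order, fits in.\<close>

definition vanishes_to :: "nat \<Rightarrow> 'a::zero fps fps \<Rightarrow> bool" where
  "vanishes_to k A \<longleftrightarrow> (\<forall>i j. i + j < k \<longrightarrow> A $ j $ i = 0)"

lemma vanishes_to_mult:
  fixes A B :: "complex fps fps"
  assumes "vanishes_to k A" "vanishes_to l B"
  shows "vanishes_to (k + l) (A * B)"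
  unfolding vanishes_to_def
proof (intro allI impI)
  fix i j assume ij: "i + j < k + l"
  have "A $ b $ a * B $ (j - b) $ (i - a) = 0" if "a \<le> i" "b \<le> j" for a b
  proof (cases "a + b < k")
    case False
    then have "(i - a) + (j - b) < l" using ij that by linarith
    then show ?thesis using assms by (simp add: vanishes_to_def)
  qed (use assms in \<open>simp add: vanishes_to_def\<close>)
  then have "(\<Sum>b=0..j. \<Sum>a=0..i. A $ b $ a * B $ (j - b) $ (i - a)) = 0"
    by (intro sum.neutral ballI) (simp del: mult_eq_0_iff)
  then show "(A * B) $ j $ i = 0"
    by (simp add: fps_mult_nth fps_sum_nth)
qed

text \<open>The product of the lowest homogeneous parts is nonzero: if s and t are the least
  x-exponents occurring in them, a single pair of monomials contributes to x-exponent s + t in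
  degree k + l.\<close>

lemma exact_order_mult:
  fixes A B :: "complex fps fps"
  assumes A: "vanishes_to k A" "\<not> vanishes_to (Suc k) A"
    and B: "vanishes_to l B" "\<not> vanishes_to (Suc l) B"
  shows "\<not> vanishes_to (Suc (k + l)) (A * B)"
proof -
  have lowest: "\<exists>i\<le>n. D $ (n - i) $ i \<noteq> 0 \<and> (\<forall>a<i. D $ (n - a) $ a = 0)"
    if D: "vanishes_to n D" "\<not> vanishes_to (Suc n) D" for n and D :: "complex fps fps"
  proof -
    obtain i j where "i + j < Suc n" "D $ j $ i \<noteq> 0"
      using D(2) unfolding vanishes_to_def by blast
    moreover from this(2) have "\<not> i + j < n"
      using D(1) by (auto simp: vanishes_to_def)
    ultimately have "j = n - i" "i \<le> n" by auto
    with \<open>D $ j $ i \<noteq> 0\<close> have ex: "i \<le> n \<and> D $ (n - i) $ i \<noteq> 0" by simp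
    define i0 where "i0 = (LEAST i. i \<le> n \<and> D $ (n - i) $ i \<noteq> 0)"
    have "i0 \<le> n \<and> D $ (n - i0) $ i0 \<noteq> 0"
      unfolding i0_def using ex by (rule LeastI)
    moreover have "D $ (n - a) $ a = 0" if "a < i0" for a
      using not_less_Least[of a "\<lambda>i. i \<le> n \<and> D $ (n - i) $ i \<noteq> 0"] that calculation
      unfolding i0_def[symmetric] by auto
    ultimately show ?thesis by blast
  qed
  obtain s where s: "s \<le> k" "A $ (k - s) $ s \<noteq> 0" "\<And>a. a < s \<Longrightarrow> A $ (k - a) $ a = 0"
    using lowest[OF A] by blast
  obtain t where t: "t \<le> l" "B $ (l - t) $ t \<noteq> 0" "\<And>a. a < t \<Longrightarrow> B $ (l - a) $ a = 0"
    using lowest[OF B] by blast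
  define j where "j = (k - s) + (l - t)"
  \<comment> \<open>Two nonzero factors have degrees at least k and l with sum k + l, hence exactly
    k and l; minimality of s and t then forces a = s.\<close>
  have zero: "A $ b $ a * B $ (j - b) $ (s + t - a) = 0"
    if ab: "a \<le> s + t" "b \<le> j" "\<not> (a = s \<and> b = k - s)" for a b
  proof (rule ccontr)
    assume "A $ b $ a * B $ (j - b) $ (s + t - a) \<noteq> 0"
    then have nz: "A $ b $ a \<noteq> 0" "B $ (j - b) $ (s + t - a) \<noteq> 0" by auto
    then have "k \<le> a + b" "l \<le> (s + t - a) + (j - b)"
      using A(1) B(1) unfolding vanishes_to_def by (meson not_le)+
    then have b: "b = k - a" "a \<le> k" "j - b = l - (s + t - a)"
      using s(1) t(1) ab unfolding j_def by linarith+
    have "s \<le> a" using s(3)[of a] nz(1) b(1) by (meson not_le)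
    moreover have "t \<le> s + t - a" using t(3)[of "s + t - a"] nz(2) b(3) by (metis not_le)
    ultimately have "a = s" using ab(1) by linarith
    then show False using ab(3) b(1) by simp
  qed
  have "(A * B) $ j $ (s + t) = (\<Sum>b=0..j. \<Sum>a=0..s + t. A $ b $ a * B $ (j - b) $ (s + t - a))"
    by (simp add: fps_mult_nth fps_sum_nth)
  also have "\<dots> = (\<Sum>b=0..j. if b = k - s then A $ (k - s) $ s * B $ (l - t) $ t else 0)"
  proof (intro sum.cong refl)
    fix b assume b: "b \<in> {0..j}"
    have "A $ b $ a * B $ (j - b) $ (s + t - a) =
        (if a = s then (if b = k - s then A $ (k - s) $ s * B $ (l - t) $ t else 0) else 0)"
      if "a \<le> s + t" for a
      using zero[of a b] that b by (cases "a = s \<and> b = k - s") (auto simp: j_def)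
    then have "(\<Sum>a=0..s + t. A $ b $ a * B $ (j - b) $ (s + t - a)) =
        (\<Sum>a=0..s + t. if a = s then (if b = k - s then A $ (k - s) $ s * B $ (l - t) $ t else 0) else 0)"
      by (intro sum.cong refl) (simp del: mult_eq_0_iff)
    then show "(\<Sum>a=0..s + t. A $ b $ a * B $ (j - b) $ (s + t - a)) =
        (if b = k - s then A $ (k - s) $ s * B $ (l - t) $ t else 0)"
      by simp
  qed
  also have "\<dots> = A $ (k - s) $ s * B $ (l - t) $ t"
    by (simp add: j_def)
  finally have "(A * B) $ j $ (s + t) \<noteq> 0" using s t by simp
  moreover have "s + t + j < Suc (k + l)" using s(1) t(1) by (simp add: j_def)
  ultimately show ?thesis unfolding vanishes_to_def by blast
qed

lemma exact_order_exists:
  assumes "A \<noteq> 0"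
  obtains k where "vanishes_to k A" "\<not> vanishes_to (Suc k) A"
proof -
  obtain j i where "A $ j $ i \<noteq> 0"
    using assms by (metis fps_nonzero_nth)
  then have ex: "\<not> vanishes_to (Suc (i + j)) A" by (auto simp: vanishes_to_def)
  define k where "k = (LEAST k. \<not> vanishes_to (Suc k) A)"
  have "\<not> vanishes_to (Suc k) A" unfolding k_def using ex by (rule LeastI)
  moreover have "vanishes_to k A"
  proof (cases k)
    case (Suc l)
    then show ?thesis using not_less_Least[of l "\<lambda>k. \<not> vanishes_to (Suc k) A"] by (auto simp: k_def)
  qed (simp add: vanishes_to_def)
  ultimately show ?thesis using that by blast
qed

lemma vanishes_to_antimono: "vanishes_to l A \<Longrightarrow> k \<le> l \<Longrightarrow> vanishes_to k A"
  by (simp add: vanishes_to_def)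

lemma vanishes_to_iff_germ_mult: "vanishes_to k (germ_expansion g) \<longleftrightarrow> enat k \<le> germ_mult g"
  unfolding germ_mult_def vanishes_to_def le_INF_iff germ_partial_expansion
  by (auto simp: not_less[symmetric])

lemma vanishes_to_mult_mono:
  assumes PQ: "germ_mult P \<le> germ_mult Q" and P: "P \<noteq> 0"
    and cP: "vanishes_to k (germ_expansion (c * P))"
  shows "vanishes_to k (germ_expansion (c * Q))"
proof (cases "c = 0")
  case False
  then have "germ_expansion c \<noteq> 0" "germ_expansion P \<noteq> 0"
    using P germ_expansion_inject germ_expansion_0 by metis+
  then obtain m n where m: "vanishes_to m (germ_expansion c)" "\<not> vanishes_to (Suc m) (germ_expansion c)"
    and n: "vanishes_to n (germ_expansion P)" "\<not> vanishes_to (Suc n) (germ_expansion P)"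
    using exact_order_exists by metis
  have "\<not> vanishes_to (Suc (m + n)) (germ_expansion (c * P))"
    using exact_order_mult[OF m n] by (simp add: germ_expansion_mult)
  then have "k \<le> m + n"
    using cP vanishes_to_antimono by (metis not_less_eq_eq)
  moreover have "vanishes_to n (germ_expansion Q)"
    using n PQ order_trans by (auto simp: vanishes_to_iff_germ_mult)
  then have "vanishes_to (m + n) (germ_expansion (c * Q))"
    using vanishes_to_mult[OF m(1)] by (simp add: germ_expansion_mult)
  ultimately show ?thesis using vanishes_to_antimono by blast
qed (simp add: germ_expansion_0 vanishes_to_def)

text \<open>The coordinate germs are fixed by their series. The outer variable of a series is y, so
  x appears as a constant.\<close>

definition germ_x :: germ2 where "germ_x = (SOME g. germ_expansion g = fps_const fps_X)"
definition germ_y :: germ2 where "germ_y = (SOME g. germ_expansion g = fps_X)"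

lemma germ_expansion_x: "germ_expansion germ_x = fps_const fps_X"
proof -
  have "norm ((fps_const fps_X :: complex fps fps) $ j $ i) \<le> 1 * 1 ^ (i + j)" for i j
    by (cases "j = 0"; cases "i = 1") simp_all
  then have "convergent_fps2 (fps_const fps_X)"
    unfolding convergent_fps2_def by (intro exI[of _ 1] conjI) auto
  then obtain g where "germ_expansion g = fps_const fps_X"
    using germ_expansion_surj by metis
  then show ?thesis unfolding germ_x_def by (rule someI)
qed

lemma germ_expansion_y: "germ_expansion germ_y = fps_X"
proof -
  have "norm ((fps_X :: complex fps fps) $ j $ i) \<le> 1 * 1 ^ (i + j)" for i j
    by (cases "j = 1"; cases "i = 0") simp_all
  then have "convergent_fps2 fps_X"
    unfolding convergent_fps2_def by (intro exI[of _ 1] conjI) auto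
  then obtain g where "germ_expansion g = fps_X"
    using germ_expansion_surj by metis
  then show ?thesis unfolding germ_y_def by (rule someI)
qed

lemma germ_y_nonzero: "germ_y \<noteq> 0"
  using germ_expansion_y germ_expansion_0 by (metis fps_X_neq_zero)

text \<open>Coefficient 0 is the restriction to the line y = 0, and removing a factor y only shifts
  the series, which stays convergent.\<close>

lemma germ_y_dvd_iff: "germ_y dvd g \<longleftrightarrow> germ_expansion g $ 0 = 0"
proof
  assume g: "germ_expansion g $ 0 = 0"
  have "convergent_fps2 (fps_shift 1 (germ_expansion g))"
    using convergent_fps2_shift convergent_germ_expansion by blast
  then obtain h where h: "germ_expansion h = fps_shift 1 (germ_expansion g)"
    using germ_expansion_surj by metis
  have "germ_expansion g = germ_expansion (germ_y * h)"
    unfolding germ_expansion_mult germ_expansion_y h fps_eq_iff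
    using g by (auto simp: fps_eq_iff)
  then show "germ_y dvd g" by (simp add: germ_expansion_inject)
qed (auto simp: germ_expansion_mult germ_expansion_y)

section \<open>Relatively prime germs\<close>

lemma relatively_prime_dvd_left:
  "relatively_prime P Q \<Longrightarrow> P' dvd P \<Longrightarrow> relatively_prime P' Q"
  unfolding relatively_prime_def using dvd_trans by blast

text \<open>The colon ideal \<open>J = (P : Q)\<close> is saturated with respect to \<open>y\<close>, hence generated by any
  \<open>W \<in> J\<close> for which \<open>W(x, 0)\<close> is nonzero of minimal order: formal division of \<open>f \<in> J\<close> by \<open>W\<close> leaves no
  remainder. Then \<open>P = W d\<close> and \<open>Q = d e\<close>, so \<open>d\<close> is a unit and \<open>J = (P)\<close>.\<close>

lemma relatively_prime_dvd_mult_regular: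
  assumes rp: "relatively_prime P Q" and P0: "germ_expansion P $ 0 \<noteq> 0" and dvd: "P dvd b * Q"
  shows "P dvd b"
proof -
  define J where "J = {f. P dvd f * Q}"
  have J_mult: "c * f \<in> J" if "f \<in> J" for c f
    using that dvd_mult[of P "f * Q" c] by (simp add: J_def mult.assoc)
  have J_diff: "f - g \<in> J" if "f \<in> J" "g \<in> J" for f g
    using that by (auto simp: J_def left_diff_distrib)
  \<comment> \<open>On y = 0 the relation becomes P(x, 0) g(x, 0) = 0 with P(x, 0) nonzero, so y
    divides g and can be cancelled.\<close>
  have J_y: "f \<in> J" if "germ_y * f \<in> J" for f
  proof -
    obtain g where g: "germ_y * f * Q = P * g" using \<open>germ_y * f \<in> J\<close> by (auto simp: J_def)
    have "(germ_expansion P * germ_expansion g) $ 0 = 0"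
      unfolding germ_expansion_mult[symmetric] g[symmetric]
      by (simp add: germ_expansion_mult germ_expansion_y)
    then have "germ_y dvd g" using P0 by (simp add: germ_y_dvd_iff)
    then obtain h where "g = germ_y * h" ..
    then have "germ_y * (f * Q) = germ_y * (P * h)" using g by (simp add: mult_ac)
    then have "f * Q = P * h" using germ_y_nonzero by simp
    then show ?thesis by (simp add: J_def)
  qed
  have "P \<in> J" by (simp add: J_def)
  then obtain W where W: "W \<in> J" "germ_expansion W $ 0 \<noteq> 0"
    and least: "\<And>f. f \<in> J \<Longrightarrow> germ_expansion f $ 0 \<noteq> 0 \<Longrightarrow>
      subdegree (germ_expansion W $ 0) \<le> subdegree (germ_expansion f $ 0)"
    using ex_has_least_nat[of "\<lambda>f. f \<in> J \<and> germ_expansion f $ 0 \<noteq> 0" P "\<lambda>f. subdegree (germ_expansion f $ 0)"] P0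
    by blast
  \<comment> \<open>By minimality of its order W(x, 0) divides f(x, 0). The quotient c depends on x
    only, what remains is a multiple of y, and saturation keeps f' in J.\<close>
  have step: "\<exists>c f'. f' \<in> J \<and> f = c * W + germ_y * f' \<and> germ_expansion c = fps_const (germ_expansion c $ 0)"
    if f: "f \<in> J" for f
  proof -
    have "germ_expansion W $ 0 dvd germ_expansion f $ 0"
      using least[OF f] W(2) by (cases "germ_expansion f $ 0 = 0") (auto simp: fps_dvd_iff)
    then obtain q where q: "germ_expansion f $ 0 = germ_expansion W $ 0 * q" ..
    have conv: "convergent_fps2 (fps_const (germ_expansion g $ 0))" for g
      using convergent_fps2_const_shift[OF convergent_germ_expansion[of g], of 0] by simp
    \<comment> \<open>The one-variable case of convergence of quotients, with all series constant in
      y.\<close>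
    have "convergent_fps2 (fps_const q)"
    proof (rule convergent_fps2_quotient[of "fps_const (germ_expansion W $ 0)"])
      show "convergent_fps2 (fps_const (germ_expansion W $ 0) * fps_const q)"
        using conv[of f] by (simp add: q)
    qed (use conv W in auto)
    then obtain c where c: "germ_expansion c = fps_const q"
      using germ_expansion_surj by metis
    have "germ_y dvd f - c * W"
      by (simp add: germ_y_dvd_iff germ_expansion_simps c q mult.commute)
    then obtain f' where f': "f - c * W = germ_y * f'" ..
    then have "f' \<in> J" using J_y J_diff[OF f J_mult[OF W(1)]] by metis
    moreover have "f = c * W + germ_y * f'" using f' by (simp add: algebra_simps)
    ultimately show ?thesis using c by (intro exI[of _ c] exI[of _ f']) simp
  qed
  have W_dvd: "W dvd f" if f: "f \<in> J" for f
  proof -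
    obtain c n where cn: "\<And>f. f \<in> J \<Longrightarrow> n f \<in> J" "\<And>f. f \<in> J \<Longrightarrow> f = c f * W + germ_y * n f"
      "\<And>f. f \<in> J \<Longrightarrow> germ_expansion (c f) = fps_const (germ_expansion (c f) $ 0)"
      using step by metis
    \<comment> \<open>Iterating the division: s k is the remainder at stage k, freed of its power of
      y, and q k collects in y-degree i the quotient found at stage k + i.\<close>
    define s where "s k = (n ^^ k) f" for k
    have s: "s k \<in> J" for k
      unfolding s_def using f cn(1) by (induction k) auto
    define q where "q k = Abs_fps (\<lambda>i. germ_expansion (c (s (k + i))) $ 0)" for k
    have q: "q k = germ_expansion (c (s k)) + fps_X * q (Suc k)" for k
      by (subst cn(3)[OF s]) (auto simp: fps_eq_iff q_def)
    have sk: "germ_expansion (s k) = germ_expansion (c (s k)) * germ_expansion W + fps_X * germ_expansion (s (Suc k))" for k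
      using arg_cong[OF cn(2)[OF s[of k]], of germ_expansion]
      by (simp add: germ_expansion_simps germ_expansion_y s_def)
    \<comment> \<open>All stages are treated at once, because the claim in degree Suc i at stage k
      rests on degree i at stage Suc k.\<close>
    have "germ_expansion (s k) $ i = (germ_expansion W * q k) $ i" for i k
    proof (induction i arbitrary: k)
      case 0
      show ?case by (subst sk, subst q) (simp add: mult.commute)
    next
      case (Suc i)
      have "germ_expansion (s k) $ Suc i = (germ_expansion (c (s k)) * germ_expansion W) $ Suc i + germ_expansion (s (Suc k)) $ i"
        by (subst sk) simp
      also have "\<dots> = (germ_expansion (c (s k)) * germ_expansion W + fps_X * (germ_expansion W * q (Suc k))) $ Suc i"
        using Suc.IH by simp
      also have "germ_expansion (c (s k)) * germ_expansion W + fps_X * (germ_expansion W * q (Suc k)) = germ_expansion W * q k"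
        by (subst q[of k]) (simp add: algebra_simps)
      finally show ?case .
    qed
    from this[of 0] have fq: "germ_expansion f = germ_expansion W * q 0"
      by (simp add: fps_eq_iff s_def)
    \<comment> \<open>The formal quotient q 0 becomes a germ here: it converges since W(x, 0) is
      nonzero.\<close>
    have "convergent_fps2 (q 0)"
      using convergent_fps2_quotient[of "germ_expansion W" "q 0"] fq convergent_germ_expansion W by metis
    then obtain g where "germ_expansion g = q 0" using germ_expansion_surj by metis
    then have "f = W * g"
      using fq by (simp add: germ_expansion_mult flip: germ_expansion_inject)
    then show ?thesis by simp
  qed
  obtain d where d: "P = W * d" using W_dvd[OF \<open>P \<in> J\<close>] ..
  obtain e where "W * Q = P * e" using W(1) by (auto simp: J_def)
  then have "W * Q = W * (d * e)" using d by (simp add: mult_ac)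
  moreover have "W \<noteq> 0" using W(2) by (auto simp: germ_expansion_0)
  ultimately have "Q = d * e" by simp
  then have "d dvd 1" using rp d by (auto simp: relatively_prime_def)
  then obtain u where "1 = d * u" ..
  then have "W = P * u" using d by (simp add: mult.assoc)
  then have "P dvd W" by (rule dvdI)
  moreover have "W dvd b" using dvd by (intro W_dvd) (simp add: J_def)
  ultimately show ?thesis by (rule dvd_trans)
qed

text \<open>The subdegree of the expansion is the exponent of y in P. While y divides P, coprimality
  keeps it from dividing Q, so it divides b, and one factor y is cancelled from both P and
  b.\<close>

lemma relatively_prime_dvd_mult:
  assumes "relatively_prime P Q" "P \<noteq> 0" "P dvd b * Q"
  shows "P dvd b"
  using assms
proof (induction "subdegree (germ_expansion P)" arbitrary: P b)
  case 0
  have "germ_expansion P \<noteq> 0" using 0 germ_expansion_inject germ_expansion_0 by metis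
  then have "germ_expansion P $ 0 \<noteq> 0" using 0(1) by (metis nth_subdegree_nonzero)
  then show ?case using 0 relatively_prime_dvd_mult_regular by blast
next
  case (Suc t)
  then have "germ_expansion P $ 0 = 0" by (metis nth_less_subdegree_zero zero_less_Suc)
  then obtain P1 where P1: "P = germ_y * P1" using germ_y_dvd_iff by (metis dvdE)
  have "\<not> germ_y dvd 1"
    by (simp add: germ_y_dvd_iff germ_expansion_1)
  then have Q0: "germ_expansion Q $ 0 \<noteq> 0"
    using Suc.prems(1) P1 by (auto simp: relatively_prime_def germ_y_dvd_iff[symmetric])
  obtain g where g: "b * Q = P * g" using Suc.prems(3) ..
  have "(germ_expansion b * germ_expansion Q) $ 0 = 0"
    unfolding germ_expansion_mult[symmetric] g P1
    by (simp add: germ_expansion_mult germ_expansion_y)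
  then have "germ_y dvd b" using Q0 by (simp add: germ_y_dvd_iff)
  then obtain b1 where b1: "b = germ_y * b1" ..
  have "germ_y * (b1 * Q) = germ_y * (P1 * g)" using g b1 P1 by (simp add: mult_ac)
  then have "P1 dvd b1 * Q" using germ_y_nonzero by simp
  moreover have "P1 \<noteq> 0" using Suc.prems(2) P1 by auto
  moreover have "relatively_prime P1 Q" using Suc.prems(1) P1 relatively_prime_dvd_left by auto
  moreover have "t = subdegree (germ_expansion P1)"
  proof -
    have "germ_expansion P1 \<noteq> 0" using \<open>P1 \<noteq> 0\<close> germ_expansion_inject germ_expansion_0 by metis
    then show ?thesis using Suc(2) by (simp add: P1 germ_expansion_mult germ_expansion_y)
  qed
  ultimately have "P1 dvd b1" using Suc.hyps(1) by blast
  then show ?case using P1 b1 by (simp add: mult_dvd_mono)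
qed

section \<open>Powers of the maximal ideal and the dimension formula\<close>

lemma vanishing_ideal: "GI.subspace {g. vanishes_to k (germ_expansion g)}"
  unfolding GI.subspace_def
proof (intro conjI ballI allI)
  show "c * g \<in> {g. vanishes_to k (germ_expansion g)}" if "g \<in> {g. vanishes_to k (germ_expansion g)}" for c g
    using vanishes_to_mult[of 0 "germ_expansion c" k "germ_expansion g"] that
    by (simp add: germ_expansion_mult) (simp add: vanishes_to_def)
qed (auto simp: germ_expansion_simps vanishes_to_def)

text \<open>A germ g of order at least k + 1 splits as x a + y b, where y b collects the monomials
  containing y and a is g(x, 0) / x; both a and b have order at least k.\<close>

lemma ideal_power_max_ideal: "ideal_power max_ideal k = {g. vanishes_to k (germ_expansion g)}"
proof (induction k)
  case 0
  show ?case by (auto simp: vanishes_to_def)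
next
  case (Suc k)
  have mx: "max_ideal = {g. vanishes_to 1 (germ_expansion g)}"
    by (auto simp: max_ideal_def germ_at_0_expansion vanishes_to_def)
  show ?case
  proof (intro equalityI)
    show "ideal_power max_ideal (Suc k) \<subseteq> {g. vanishes_to (Suc k) (germ_expansion g)}"
      unfolding ideal_power.simps ideal_prod_def ideal_gen_def Suc.IH unfolding mx
      using vanishes_to_mult[of 1 _ k]
      by (intro GI.span_minimal vanishing_ideal) (auto simp: germ_expansion_mult)
    show "{g. vanishes_to (Suc k) (germ_expansion g)} \<subseteq> ideal_power max_ideal (Suc k)"
    proof
      fix g assume "g \<in> {g. vanishes_to (Suc k) (germ_expansion g)}"
      then have g: "germ_expansion g $ j $ i = 0" if "i + j < Suc k" for i j
        using that by (simp add: vanishes_to_def)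
      have "convergent_fps2 (fps_shift 1 (germ_expansion g))"
        using convergent_fps2_shift convergent_germ_expansion by blast
      then obtain b where b: "germ_expansion b = fps_shift 1 (germ_expansion g)"
        using germ_expansion_surj by metis
      have "convergent_fps2 (fps_const (fps_shift 1 (germ_expansion g $ 0)))"
        using convergent_fps2_const_shift convergent_germ_expansion by blast
      then obtain a where a: "germ_expansion a = fps_const (fps_shift 1 (germ_expansion g $ 0))"
        using germ_expansion_surj by metis
      have "germ_expansion g = germ_expansion (germ_x * a + germ_y * b)"
      proof (subst fps_eq_iff, rule allI)
        fix j
        show "germ_expansion g $ j = germ_expansion (germ_x * a + germ_y * b) $ j"
        proof (cases j)
          case 0
          have "germ_expansion g $ 0 $ i = (fps_X * fps_shift 1 (germ_expansion g $ 0)) $ i" for i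
            using g[of 0 0] by (cases i) auto
          then have "germ_expansion g $ 0 = fps_X * fps_shift 1 (germ_expansion g $ 0)"
            by (simp add: fps_eq_iff)
          then show ?thesis
            by (simp add: 0 germ_expansion_simps germ_expansion_x germ_expansion_y a)
        next
          case (Suc l)
          then show ?thesis
            by (simp add: germ_expansion_simps germ_expansion_x germ_expansion_y a b)
        qed
      qed
      then have "g = germ_x * a + germ_y * b" by (simp add: germ_expansion_inject)
      moreover have "a \<in> ideal_power max_ideal k" "b \<in> ideal_power max_ideal k"
        unfolding Suc.IH using g by (auto simp: vanishes_to_def a b)
      moreover have "germ_x \<in> max_ideal" "germ_y \<in> max_ideal"
        by (auto simp: mx vanishes_to_def germ_expansion_x germ_expansion_y)
      ultimately show "g \<in> ideal_power max_ideal (Suc k)"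
        unfolding ideal_power.simps ideal_prod_def ideal_gen_def
        by (simp only:) (rule GI.span_add; rule GI.span_base; blast)
    qed
  qed
qed

section \<open>Multiplication maps and ideals with one or two generators\<close>

lemma linear_germ_mult:
  "Vector_Spaces.linear (\<lambda>c g. germ_const c * g) (\<lambda>c g. germ_const c * g) ((*) (P::germ2))"
  unfolding Vector_Spaces.linear_iff
  using GV.vector_space_axioms by (simp add: distrib_left mult.left_commute)

lemma ideal_gen_pair: "ideal_gen {P, Q} = {P * a + Q * b | a b. True}"
  unfolding ideal_gen_def GI.span_insert[of P] GI.span_singleton
proof (intro equalityI subsetI)
  fix f assume "f \<in> {x. \<exists>k. x - k * P \<in> range (\<lambda>k. k * Q)}"
  then obtain a b where "f - a * P = b * Q" by blast
  then have "f = P * a + Q * b" by (simp add: algebra_simps)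
  then show "f \<in> {P * a + Q * b | a b. True}" by blast
next
  fix f assume "f \<in> {P * a + Q * b | a b. True}"
  then obtain a b where "f = P * a + Q * b" by blast
  then have "f - a * P = b * Q" by (simp add: algebra_simps)
  then show "f \<in> {x. \<exists>k. x - k * P \<in> range (\<lambda>k. k * Q)}" by blast
qed

lemma ideal_gen_single: "ideal_gen {P} = range ((*) P)"
  unfolding ideal_gen_def GI.span_singleton by (auto simp: mult.commute)

lemma ideal_prod_span: "ideal_prod I J = GI.span {a * b | a b. a \<in> I \<and> b \<in> J}"
  by (simp add: ideal_prod_def ideal_gen_def)

text \<open>Because N is an ideal it absorbs the coefficients of P and Q, and the two-term sums
  already form an ideal.\<close>

lemma ideal_prod_pair:
  assumes N: "GI.subspace N"
  shows "ideal_prod (ideal_gen {P, Q}) N = {P * m + Q * n | m n. m \<in> N \<and> n \<in> N}" (is "_ = ?R")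
proof
  have sub: "GI.subspace ?R"
    unfolding GI.subspace_def
  proof (intro conjI ballI allI)
    show "0 \<in> ?R" using GI.subspace_0[OF N] by force
  next
    fix x y assume "x \<in> ?R" "y \<in> ?R"
    then obtain m n m' n' where "x = P * m + Q * n" "y = P * m' + Q * n'"
      and *: "m \<in> N" "n \<in> N" "m' \<in> N" "n' \<in> N" by blast
    then have "x + y = P * (m + m') + Q * (n + n')" by (simp add: algebra_simps)
    then show "x + y \<in> ?R" using * GI.subspace_add[OF N] by blast
  next
    fix c x assume "x \<in> ?R"
    then obtain m n where "x = P * m + Q * n" and *: "m \<in> N" "n \<in> N" by blast
    then have "c * x = P * (c * m) + Q * (c * n)" by (simp add: algebra_simps)
    then show "c * x \<in> ?R" using * GI.subspace_scale[OF N] by blast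
  qed
  show "ideal_prod (ideal_gen {P, Q}) N \<subseteq> ?R"
    unfolding ideal_prod_span
  proof (rule GI.span_minimal[OF _ sub], safe)
    fix f n assume "f \<in> ideal_gen {P, Q}" and n: "n \<in> N"
    then obtain a b where "f = P * a + Q * b" by (auto simp: ideal_gen_pair)
    then have "f * n = P * (a * n) + Q * (b * n)" by (simp add: algebra_simps)
    then show "\<exists>m n'. f * n = P * m + Q * n' \<and> m \<in> N \<and> n' \<in> N"
      using n GI.subspace_scale[OF N] by blast
  qed
  show "?R \<subseteq> ideal_prod (ideal_gen {P, Q}) N"
  proof safe
    fix m n assume "m \<in> N" "n \<in> N"
    moreover have "P \<in> ideal_gen {P, Q}" "Q \<in> ideal_gen {P, Q}"
      by (auto simp: ideal_gen_def intro: GI.span_base)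
    ultimately show "P * m + Q * n \<in> ideal_prod (ideal_gen {P, Q}) N"
      unfolding ideal_prod_span
      by (intro GI.span_add GI.span_base) auto
  qed
qed

theorem mainTheorem1:
  fixes P Q :: germ2 and k :: nat
  assumes "singular_foliation P Q"
    and "foliation_mult P Q = germ_mult P" and "germ_mult P \<le> germ_mult Q"
  shows "milnor_k k P Q =
    milnor P Q + quot_dim (ideal_power max_ideal k)
      + quot_dim (ideal_gen {P} + ideal_power max_ideal k)"
proof -
  have rp: "relatively_prime P Q" and Qm: "Q \<in> max_ideal" and Pm: "P \<in> max_ideal"
    using assms(1) by (auto simp: singular_foliation_def)
  have unit: "\<not> f dvd 1" if "f \<in> max_ideal" for f
  proof
    assume "f dvd 1"
    then obtain g where "1 = f * g" ..
    then have "germ_expansion 1 $ 0 $ 0 = germ_expansion f $ 0 $ 0 * germ_expansion g $ 0 $ 0"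
      using germ_expansion_mult[of f g] by simp
    then show False using that by (simp add: germ_at_0_expansion germ_expansion_1 max_ideal_def)
  qed
  \<comment> \<open>If P were 0, then Q would be a common divisor of P and Q, hence a unit.\<close>
  have P0: "P \<noteq> 0"
    using rp unit[OF Qm] by (auto simp: relatively_prime_def)
  define N where "N = ideal_power max_ideal k"
  have NV: "N = {g. vanishes_to k (germ_expansion g)}"
    by (simp add: N_def ideal_power_max_ideal)
  have N: "GI.subspace N" unfolding NV by (rule vanishing_ideal)
  define W0 where "W0 = {P * m + Q * n | m n. m \<in> N \<and> n \<in> N}"
  define W1 where "W1 = range ((*) P) + W0"
  have W0_eq: "W0 = ideal_prod (ideal_gen {P, Q}) N"
    by (simp add: W0_def ideal_prod_pair[OF N])
  have W0: "GI.subspace W0" unfolding W0_eq ideal_prod_span by (rule GI.subspace_span)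
  have W1_eq: "W1 = {P * a + Q * n | a n. n \<in> N}"
  proof (intro equalityI subsetI)
    fix f assume "f \<in> W1"
    then obtain a m n where "f = P * a + (P * m + Q * n)" "n \<in> N"
      by (auto simp: W1_def W0_def set_plus_def)
    then have "f = P * (a + m) + Q * n" by (simp add: algebra_simps)
    then show "f \<in> {P * a + Q * n | a n. n \<in> N}" using \<open>n \<in> N\<close> by blast
  next
    fix f assume "f \<in> {P * a + Q * n | a n. n \<in> N}"
    then obtain a n where f: "f = P * a + (P * 0 + Q * n)" "n \<in> N" by auto
    then show "f \<in> W1" unfolding W1_def W0_def
      using GI.subspace_0[OF N] by (blast intro: set_plus_intro)
  qed
  have W1: "GV.subspace W1"
  proof -
    have "GI.subspace (range ((*) P))"
      using GI.subspace_span[of "{P}"] by (simp add: ideal_gen_single[symmetric] ideal_gen_def)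
    then have "GV.subspace {x + y | x y. x \<in> range ((*) P) \<and> y \<in> W0}"
      using W0 by (intro GV.subspace_sums ideal_imp_GV_subspace)
    moreover have "{x + y | x y. x \<in> range ((*) P) \<and> y \<in> W0} = W1"
      unfolding W1_def set_plus_def by blast
    ultimately show ?thesis by simp
  qed
  have W2_eq: "ideal_gen {P, Q} = range ((*) Q) + W1"
  proof (intro equalityI subsetI)
    fix f assume "f \<in> ideal_gen {P, Q}"
    then obtain a b where f: "f = Q * b + (P * a + Q * 0)" by (auto simp: ideal_gen_pair add.commute)
    then show "f \<in> range ((*) Q) + W1" unfolding W1_eq
      using GI.subspace_0[OF N] by (blast intro: set_plus_intro)
  next
    fix f assume "f \<in> range ((*) Q) + W1"
    then obtain b a n where "f = Q * b + (P * a + Q * n)" by (auto simp: W1_eq set_plus_def)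
    then have "f = P * a + Q * (b + n)" by (simp add: algebra_simps)
    then show "f \<in> ideal_gen {P, Q}" by (auto simp: ideal_gen_pair)
  qed
  \<comment> \<open>A relation P (a - m) = Q n makes the pair (a - m, n) a multiple c (Q, P) of the
    trivial syzygy.\<close>
  have K1: "(*) P -` W0 = N"
  proof (intro equalityI subsetI)
    fix a assume "a \<in> (*) P -` W0"
    then obtain m n where mn: "P * a = P * m + Q * n" "m \<in> N" "n \<in> N" by (auto simp: W0_def)
    then have "n * Q = P * (a - m)" by (simp add: algebra_simps)
    then have "P dvd n" using relatively_prime_dvd_mult[OF rp P0] by (metis dvd_triv_left)
    then obtain c where c: "n = P * c" ..
    then have "P * (a - m) = P * (c * Q)" using \<open>n * Q = P * (a - m)\<close>[symmetric] by (simp only: c mult.assoc)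
    then have "a - m = c * Q" using P0 by simp
    moreover have "c * Q \<in> N"
      using vanishes_to_mult_mono[OF assms(3) P0, of k c] mn(3) c by (simp add: NV mult.commute)
    ultimately have "m + c * Q \<in> N" "a = m + c * Q"
      using mn GI.subspace_add[OF N] by (auto simp: algebra_simps)
    then show "a \<in> N" by simp
  next
    fix a assume "a \<in> N"
    then have "P * a + Q * 0 \<in> W0" using GI.subspace_0[OF N] unfolding W0_def by blast
    then show "a \<in> (*) P -` W0" by simp
  qed
  \<comment> \<open>The same syzygy argument, applied to Q (b - n) = P a.\<close>
  have K2: "(*) Q -` W1 = ideal_gen {P} + N"
  proof (intro equalityI subsetI)
    fix b assume "b \<in> (*) Q -` W1"
    then obtain a n where an: "Q * b = P * a + Q * n" "n \<in> N" by (auto simp: W1_eq)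
    then have "(b - n) * Q = P * a" by (simp add: algebra_simps)
    then have "P dvd b - n" using relatively_prime_dvd_mult[OF rp P0] by (metis dvd_triv_left)
    then obtain c where "b - n = P * c" ..
    then have "b = P * c + n" by (simp add: algebra_simps)
    then show "b \<in> ideal_gen {P} + N" using an(2) by (auto simp: ideal_gen_single)
  next
    fix b assume "b \<in> ideal_gen {P} + N"
    then obtain c n where "b = P * c + n" and n: "n \<in> N" by (auto simp: ideal_gen_single set_plus_def)
    then have "Q * b = P * (Q * c) + Q * n" by (simp add: algebra_simps)
    then show "b \<in> (*) Q -` W1" using n by (auto simp: W1_eq)
  qed
  have "quot_dim W0 = quot_dim W1 + quot_dim N"
    using quot_dim_subspace_eq[OF ideal_imp_GV_subspace[OF W0] linear_germ_mult W1_def] K1 by simp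
  moreover have "quot_dim W1 = quot_dim (ideal_gen {P, Q}) + quot_dim (ideal_gen {P} + N)"
    using quot_dim_subspace_eq[OF W1 linear_germ_mult W2_eq] K2 by simp
  ultimately show ?thesis
    unfolding milnor_k_def milnor_def N_def[symmetric] W0_eq[symmetric] by (simp add: add_ac)
qed

end
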